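(* Let $d\ge1$. Three unit simplices in $3\Delta_{d-1}$ can be extended to a fine mixed subdivision of $3\Delta_{d-1}$ (that is, there is a fine mixed subdivision of $3\Delta_{d-1}$ having these three simplices among its cells) if and only if they are spread out.
   Context: Notation: $\Delta_{d-1}$ is the convex hull of the standard basis vectors $w_1,\dots,w_d$ of $\mathbb R^d$, and $n\Delta_{d-1}$ is its dilation by $n$. Fine mixed subdivisions: a fine mixed cell is a Minkowski sum $B_1+\cdots+B_n$ of nonempty faces $B_i$ of $\Delta_{d-1}$ which lie in independent affine subspaces (i.e. $\dim(B_1+\cdots+B_n)=\sum_i\dim B_i$) and whose dimensions add up to $d-1$. A fine mixed subdivision of $n\Delta_{d-1}$ is a polyhedral subdivision of $n\Delta_{d-1}$ into fine mixed cells such that the intersection of any two cells is a face of both. Simplices and spread out collections: the unit simplices in $n\Delta_{d-1}$ are the translates $x+\Delta_{d-1}$ where the position $x=(x_1,\dots,x_d)$ is a vector of non-negative integers with $x_1+\cdots+x_d=n-1$. "Three simplices" means a collection of three distinct unit simplices. A sub-simplex of size $k$ ($1\le k\le n$) of $n\Delta_{d-1}$ is a set $\{x\in n\Delta_{d-1}: x_a\ge m_a \text{ for all } a\}$ for non-negative integers $m_1,\dots,m_d$ with $m_1+\cdots+m_d=n-k$; it contains the unit simplex with position $x$ if and only if $x_a\ge m_a$ for all $a$. A collection of $n$ unit simplices in $n\Delta_{d-1}$ is spread out if, for every $k$, no sub-simplex of size $k$ contains more than $k$ of them. The claim uses $n=3$. *)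

theory Defs
  imports "HOL-Analysis.Analysis"
begin

text \<open>The ambient space is \<open>real^'d\<close> with \<open>d = CARD('d) \<ge> 1\<close>.\<close>

definition std_simplex :: "(real^'d) set" where
  "std_simplex = convex hull (range (\<lambda>a. axis a 1))"

definition dilated_simplex :: "nat \<Rightarrow> (real^'d) set" where
  "dilated_simplex n = (\<lambda>x. real n *\<^sub>R x) ` std_simplex"

text \<open>The sum \<open>\<Sum>i<n. B i\<close> below is the Minkowski sum of sets (from \<open>Set_Algebras\<close>).\<close>

definition fine_mixed_cell :: "nat \<Rightarrow> (real^'d) set \<Rightarrow> bool" where
  "fine_mixed_cell n C \<longleftrightarrow>
    (\<exists>B :: nat \<Rightarrow> (real^'d) set.
       (\<forall>i<n. B i face_of std_simplex \<and> B i \<noteq> {}) \<and>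
       C = (\<Sum>i<n. B i) \<and>
       aff_dim (\<Sum>i<n. B i) = (\<Sum>i<n. aff_dim (B i)) \<and>
       (\<Sum>i<n. aff_dim (B i)) = int CARD('d) - 1)"

text \<open>A subdivision is given by its set of maximal cells, which are the fine mixed cells.
  In \<open>face_of\<close> the empty set is a face, so disjoint cells are allowed; as all cells have
  dimension \<open>d - 1\<close>, distinct cells cannot overlap in their relative interiors.\<close>

definition fine_mixed_subdivision :: "nat \<Rightarrow> (real^'d) set set \<Rightarrow> bool" where
  "fine_mixed_subdivision n \<C> \<longleftrightarrow>
     finite \<C> \<and>
     (\<forall>C\<in>\<C>. fine_mixed_cell n C) \<and>
     \<Union>\<C> = dilated_simplex n \<and>
     (\<forall>C\<in>\<C>. \<forall>D\<in>\<C>. (C \<inter> D) face_of C \<and> (C \<inter> D) face_of D)"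

definition unit_simplex :: "('d::finite \<Rightarrow> nat) \<Rightarrow> (real^'d) set" where
  "unit_simplex x = (\<lambda>y. (\<chi> a. real (x a)) + y) ` std_simplex"

definition unit_simplices :: "nat \<Rightarrow> (real^'d) set set" where
  "unit_simplices n = {unit_simplex x | x. (\<Sum>a\<in>UNIV. x a) + 1 = n}"

definition sub_simplices :: "nat \<Rightarrow> nat \<Rightarrow> (real^'d) set set" where
  "sub_simplices n k =
     {{x \<in> dilated_simplex n. \<forall>a. x $ a \<ge> real (m a)} | m :: 'd \<Rightarrow> nat.
        (\<Sum>a\<in>UNIV. m a) + k = n}"

definition spread_out :: "nat \<Rightarrow> (real^'d) set set \<Rightarrow> bool" where
  "spread_out n \<S> \<longleftrightarrow>
     (\<forall>k\<in>{1..n}. \<forall>R\<in>sub_simplices n k. card {S \<in> \<S>. S \<subseteq> R} \<le> k)"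

end

theory Submission
  imports Defs
begin

text \<open>A unit simplex of \<open>3\<Delta>\<close> is given by a position of degree 2, that is, by an edge or loop
  \<open>{i, j}\<close> on the set of coordinates: the position is \<open>e\<^sub>i + e\<^sub>j\<close>. Of the sub-simplices only those
  of size 2 restrict three simplices, so three edges are spread out if and only if no coordinate
  lies on all of them (\<open>spread_out_3_iff\<close>).

  \<^bold>\<open>Necessity.\<close> If a coordinate \<open>a\<close> is common to all three, the positions are \<open>e\<^sub>a + e\<^sub>i\<close>,
  \<open>e\<^sub>a + e\<^sub>j\<close>, \<open>e\<^sub>a + e\<^sub>k\<close>. The three simplices meet pairwise in points and surround a triangular
  hole with barycentre \<open>q = e\<^sub>a + 2/3 (e\<^sub>i + e\<^sub>j + e\<^sub>k)\<close>. Some cell \<open>C\<close>, the sum of three faces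
  of \<open>\<Delta>\<close>, contains \<open>q\<close>, and accordingly \<open>q = f + g + h\<close>. A face contains every
  vertex that occurs with positive weight in one of its points, so the supports of \<open>f\<close>, \<open>g\<close> and
  \<open>h\<close> yield lattice points of \<open>C\<close>. As the matrix with rows \<open>f\<close>, \<open>g\<close>, \<open>h\<close> has prescribed row and
  column sums, its support is rich enough to give two lattice points \<open>p\<close> and \<open>p'\<close> of \<open>C\<close> such that
  the midpoint of \<open>p\<close> and \<open>p'\<close> lies in one of the three simplices and \<open>p'\<close> does not. Then the
  intersection of \<open>C\<close> with this simplex is not a face of \<open>C\<close>.

  \<^bold>\<open>Sufficiency.\<close> The subdivision is a regular one. Weights \<open>W\<^sub>l\<close> in \<open>\<real>\<^sup>d\<close> for \<open>l < n\<close> assign to each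
  vector \<open>y\<close> the cell that is the sum over \<open>l\<close> of the faces spanned by the coordinates minimising
  \<open>W\<^sub>l - y\<close>. By linear programming duality these cells are the domains on which the cheapest way of
  writing a point of \<open>n\<Delta>\<close> as a sum of \<open>n\<close> points of \<open>\<Delta>\<close> has an affine cost. Hence they
  cover \<open>n\<Delta>\<close> and meet in common faces, and for generic weights those of full dimension are fine
  mixed cells (\<open>fine_mixed_subdivision_full_cells\<close>). The vector \<open>y = W\<^sub>l\<close> gives a unit simplex,
  whose position is the sum over \<open>m \<noteq> l\<close> of the basis vectors at the coordinates
  minimising \<open>W\<^sub>m - W\<^sub>l\<close>.

  So let \<open>n = 3\<close> and distribute the two ends of each edge \<open>l\<close> over the other two edges \<open>m\<close>, calling
  the end given to \<open>m\<close> the coordinate \<open>c\<^sub>l\<^sub>m\<close>. What is needed are weights for which \<open>W\<^sub>m - W\<^sub>l\<close> has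
  its only minimum at \<open>c\<^sub>l\<^sub>m\<close>. As no coordinate is common to all three edges, the ends can be
  distributed such that a coordinate shared by the edges \<open>l\<close> and \<open>m\<close> is always given to the third
  edge (\<open>edge_orientation\<close>). Then, for every coordinate \<open>c\<close>, the pairs \<open>(l, m)\<close> with \<open>c\<^sub>l\<^sub>m = c\<close>
  form a strict partial order, and the weight \<open>W\<^sub>l(c)\<close> that counts the \<open>m\<close> with \<open>c\<^sub>l\<^sub>m = c\<close> and
  subtracts the number of \<open>m\<close> with \<open>c\<^sub>m\<^sub>l = c\<close> has the required minima by a margin that
  survives a small generic perturbation (\<open>orientation_gap\<close>).\<close>


section \<open>Faces of the standard simplex and unit simplices\<close>

abbreviation vertex :: "'d \<Rightarrow> real^'d" where
  "vertex c \<equiv> axis c 1"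

definition coord_face :: "'d set \<Rightarrow> (real^'d) set" where
  "coord_face I = {b. (\<forall>c. 0 \<le> b $ c) \<and> (\<Sum>c\<in>UNIV. b $ c) = 1 \<and> (\<forall>c. c \<notin> I \<longrightarrow> b $ c = 0)}"

lemma vertex_in_coord_face: "c \<in> I \<Longrightarrow> vertex c \<in> coord_face I"
  by (auto simp: coord_face_def axis_def)

lemma convex_coord_face: "convex (coord_face I)"
  unfolding convex_def coord_face_def
  by (auto simp: sum.distrib simp flip: sum_distrib_left)

lemma coord_face_barycentric:
  assumes b: "b \<in> coord_face I"
  shows "b = (\<Sum>c\<in>I. b $ c *\<^sub>R vertex c)" and "(\<Sum>c\<in>I. b $ c) = 1"
proof -
  have "b = (\<Sum>c\<in>UNIV. b $ c *\<^sub>R vertex c)"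
    using basis_expansion[of b] by (simp add: scalar_mult_eq_scaleR)
  also have "\<dots> = (\<Sum>c\<in>I. b $ c *\<^sub>R vertex c)"
    using b by (intro sum.mono_neutral_right) (auto simp: coord_face_def)
  finally show "b = (\<Sum>c\<in>I. b $ c *\<^sub>R vertex c)" .
  have "(\<Sum>c\<in>UNIV. b $ c) = (\<Sum>c\<in>I. b $ c)"
    using b by (intro sum.mono_neutral_right) (auto simp: coord_face_def)
  then show "(\<Sum>c\<in>I. b $ c) = 1" using b by (simp add: coord_face_def)
qed

lemma coord_face_eq_hull: "coord_face I = convex hull (vertex ` I)"
proof
  show "convex hull (vertex ` I) \<subseteq> coord_face I"
    by (intro hull_minimal convex_coord_face) (auto intro: vertex_in_coord_face)
  show "coord_face I \<subseteq> convex hull (vertex ` I)"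
  proof
    fix b assume b: "b \<in> coord_face I"
    have "(\<Sum>c\<in>I. b $ c *\<^sub>R vertex c) \<in> convex hull (vertex ` I)"
      using b coord_face_barycentric(2)[OF b] by (intro convex_sum) (auto simp: coord_face_def intro: hull_inc)
    then show "b \<in> convex hull (vertex ` I)" using coord_face_barycentric(1)[OF b] by simp
  qed
qed

lemma std_simplex_eq_coord_face: "std_simplex = coord_face UNIV"
  by (simp add: std_simplex_def coord_face_eq_hull)

text \<open>The face is cut out by the supporting hyperplane on which the coordinates in \<open>I\<close> sum up to 1.\<close>

lemma coord_face_face_of: "coord_face I face_of (std_simplex :: (real^'d) set)"
proof -
  let ?a = "(\<chi> c. of_bool (c \<in> I)) :: real^'d"
  have le: "?a \<bullet> b \<le> 1" if "b \<in> std_simplex" for b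
  proof -
    have "?a \<bullet> b = (\<Sum>c\<in>UNIV. of_bool (c \<in> I) * b $ c)" by (simp add: inner_vec_def)
    also have "\<dots> \<le> (\<Sum>c\<in>UNIV. b $ c)"
      using that by (intro sum_mono) (auto simp: std_simplex_eq_coord_face coord_face_def)
    finally show ?thesis using that by (simp add: std_simplex_eq_coord_face coord_face_def)
  qed
  have "coord_face I = std_simplex \<inter> {b. ?a \<bullet> b = 1}"
  proof (intro set_eqI iffI)
    fix b assume b: "b \<in> coord_face I"
    have "?a \<bullet> b = (\<Sum>c\<in>UNIV. b $ c)"
      unfolding inner_vec_def using b by (intro sum.cong) (auto simp: coord_face_def)
    then show "b \<in> std_simplex \<inter> {b. ?a \<bullet> b = 1}"
      using b by (auto simp: std_simplex_eq_coord_face coord_face_def)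
  next
    fix b assume b: "b \<in> std_simplex \<inter> {b. ?a \<bullet> b = 1}"
    have "(\<Sum>c\<in>UNIV. b $ c - ?a $ c * b $ c) = 0"
      using b by (simp add: sum_subtractf inner_vec_def std_simplex_eq_coord_face coord_face_def)
    moreover have "0 \<le> b $ c - ?a $ c * b $ c" for c
      using b by (auto simp: std_simplex_eq_coord_face coord_face_def)
    ultimately have eq0: "b $ c - ?a $ c * b $ c = 0" for c
      by (simp add: sum_nonneg_eq_0_iff)
    then have "b $ c = 0" if "c \<notin> I" for c using that eq0[of c] by simp
    then show "b \<in> coord_face I"
      using b by (auto simp: std_simplex_eq_coord_face coord_face_def)
  qed
  moreover have "(std_simplex \<inter> {b. ?a \<bullet> b = 1}) face_of std_simplex"
    by (intro face_of_Int_supporting_hyperplane_le le) (simp_all add: std_simplex_def)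
  ultimately show ?thesis by simp
qed

text \<open>If \<open>b\<close> is not itself the vertex, it lies in the open segment from the vertex to the point that
  remains when the coordinate \<open>c\<close> of \<open>b\<close> is removed and the rest is rescaled; a face that meets an
  open segment contains its ends.\<close>

lemma vertex_in_face_of_simplex:
  fixes b :: "real^'d"
  assumes F: "F face_of std_simplex" and b: "b \<in> F" and pos: "0 < b $ c"
  shows "vertex c \<in> F"
proof (cases "b = vertex c")
  case False
  have bS: "b \<in> coord_face UNIV"
    using F b face_of_imp_subset std_simplex_eq_coord_face by blast
  have "b $ c \<noteq> 1"
  proof
    assume 1: "b $ c = 1"
    have "(\<Sum>k\<in>UNIV - {c}. b $ k) = 0"
      using bS 1 by (simp add: coord_face_def sum.remove[of UNIV c])
    then have "b $ k = 0" if "k \<noteq> c" for k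
      using bS that by (subst (asm) sum_nonneg_eq_0_iff) (auto simp: coord_face_def)
    then have "b = vertex c" using 1 by (auto simp: vec_eq_iff axis_def)
    then show False using False by simp
  qed
  moreover have "b $ c \<le> (\<Sum>k\<in>UNIV. b $ k)"
    using bS by (intro member_le_sum) (auto simp: coord_face_def)
  ultimately have lt: "b $ c < 1" using bS by (simp add: coord_face_def)
  define r where "r = (1 / (1 - b $ c)) *\<^sub>R (b - b $ c *\<^sub>R vertex c)"
  have rS: "r \<in> coord_face UNIV"
    using bS lt by (auto simp: r_def coord_face_def axis_def sum_subtractf simp flip: sum_divide_distrib sum_distrib_left)
  have b_eq: "b = (1 - b $ c) *\<^sub>R r + b $ c *\<^sub>R vertex c"
    using lt by (simp add: r_def)
  have "r \<noteq> vertex c"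
    using b_eq False by (metis add.commute diff_add_cancel scaleR_left.add scaleR_one)
  then have "b \<in> open_segment r (vertex c)"
    unfolding in_segment using b_eq pos lt by blast
  then show ?thesis
    using face_ofD[OF F _ _ _ b, of r "vertex c"] rS
    by (auto simp: std_simplex_eq_coord_face vertex_in_coord_face)
qed (use b in simp)

lemma dilated_simplex_eq:
  "dilated_simplex n = {x :: real^'d. (\<forall>c. 0 \<le> x $ c) \<and> (\<Sum>c\<in>UNIV. x $ c) = real n}"
proof (cases "n = 0")
  case True
  have "std_simplex \<noteq> ({} :: (real^'d) set)" by (simp add: std_simplex_def)
  then have "dilated_simplex n = {0 :: real^'d}"
    using True by (auto simp: dilated_simplex_def)
  moreover have "{x :: real^'d. (\<forall>c. 0 \<le> x $ c) \<and> (\<Sum>c\<in>UNIV. x $ c) = real n} = {0}"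
    using True by (auto simp: vec_eq_iff sum_nonneg_eq_0_iff)
  ultimately show ?thesis by simp
next
  case False
  show ?thesis
  proof (intro set_eqI iffI)
    fix x :: "real^'d" assume "x \<in> dilated_simplex n"
    then show "x \<in> {x. (\<forall>c. 0 \<le> x $ c) \<and> (\<Sum>c\<in>UNIV. x $ c) = real n}"
      by (auto simp: dilated_simplex_def std_simplex_eq_coord_face coord_face_def simp flip: sum_distrib_left)
  next
    fix x :: "real^'d" assume x: "x \<in> {x. (\<forall>c. 0 \<le> x $ c) \<and> (\<Sum>c\<in>UNIV. x $ c) = real n}"
    then have "(1 / real n) *\<^sub>R x \<in> std_simplex"
      using False by (auto simp: std_simplex_eq_coord_face coord_face_def simp flip: sum_divide_distrib)
    then show "x \<in> dilated_simplex n"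
      unfolding dilated_simplex_def using False by (intro image_eqI[where x="(1 / real n) *\<^sub>R x"]) auto
  qed
qed

lemma unit_simplex_eq:
  "unit_simplex x = {p :: real^'d. (\<forall>c. real (x c) \<le> p $ c) \<and> (\<Sum>c\<in>UNIV. p $ c) = real (\<Sum>c\<in>UNIV. x c) + 1}"
proof (intro set_eqI iffI)
  fix p :: "real^'d" assume "p \<in> unit_simplex x"
  then show "p \<in> {p. (\<forall>c. real (x c) \<le> p $ c) \<and> (\<Sum>c\<in>UNIV. p $ c) = real (\<Sum>c\<in>UNIV. x c) + 1}"
    by (auto simp: unit_simplex_def std_simplex_eq_coord_face coord_face_def sum.distrib)
next
  fix p :: "real^'d" assume p: "p \<in> {p. (\<forall>c. real (x c) \<le> p $ c) \<and> (\<Sum>c\<in>UNIV. p $ c) = real (\<Sum>c\<in>UNIV. x c) + 1}"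
  then have "p - (\<chi> a. real (x a)) \<in> std_simplex"
    by (auto simp: std_simplex_eq_coord_face coord_face_def sum_subtractf)
  then show "p \<in> unit_simplex x"
    unfolding unit_simplex_def by (intro image_eqI[where x="p - (\<chi> a. real (x a))"]) auto
qed

text \<open>For \<open>d \<ge> 2\<close> the corner of the unit simplex in a direction other than \<open>c\<close> has coordinate
  \<open>x c\<close> at \<open>c\<close>. For \<open>d = 1\<close> there is no such direction, and the claim holds because of the
  assumption on the sums.\<close>

lemma unit_simplex_subset_iff:
  fixes x m :: "'d::finite \<Rightarrow> nat"
  assumes sum_le: "(\<Sum>c\<in>UNIV. m c) \<le> (\<Sum>c\<in>UNIV. x c)"
  shows "unit_simplex x \<subseteq> {p. \<forall>c. real (m c) \<le> p $ c} \<longleftrightarrow> (\<forall>c. m c \<le> x c)"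
proof
  assume sub: "unit_simplex x \<subseteq> {p. \<forall>c. real (m c) \<le> p $ c}"
  show "\<forall>c. m c \<le> x c"
  proof
    fix c
    show "m c \<le> x c"
    proof (cases "\<exists>c'. c' \<noteq> c")
      case True
      then obtain c' where c': "c' \<noteq> c" by blast
      have "(\<chi> a. real (x a)) + vertex c' \<in> unit_simplex x"
        by (auto simp: unit_simplex_def std_simplex_eq_coord_face vertex_in_coord_face)
      then have "real (m c) \<le> ((\<chi> a. real (x a)) + vertex c') $ c" using sub by blast
      then show ?thesis using c' by (simp add: axis_def)
    next
      case False
      then have "UNIV = {c}" by auto
      have "(\<Sum>c\<in>UNIV. m c) = m c" "(\<Sum>c\<in>UNIV. x c) = x c"
        unfolding \<open>UNIV = {c}\<close> by simp_all
      then show ?thesis using sum_le by simp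
    qed
  qed
next
  assume le: "\<forall>c. m c \<le> x c"
  have "real (m c) \<le> p $ c" if "p \<in> unit_simplex x" for p c
  proof -
    have "real (m c) \<le> real (x c)" using le by simp
    also have "\<dots> \<le> p $ c" using that by (simp add: unit_simplex_eq)
    finally show ?thesis .
  qed
  then show "unit_simplex x \<subseteq> {p. \<forall>c. real (m c) \<le> p $ c}" by blast
qed

lemma unit_simplex_inject:
  fixes x y :: "'d::finite \<Rightarrow> nat"
  assumes "unit_simplex x = unit_simplex y" and "(\<Sum>c\<in>UNIV. x c) = (\<Sum>c\<in>UNIV. y c)"
  shows "x = y"
proof (rule ext, rule antisym)
  fix c
  have "unit_simplex x \<subseteq> {p. \<forall>c. real (y c) \<le> p $ c}" "unit_simplex y \<subseteq> {p. \<forall>c. real (x c) \<le> p $ c}"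
    using assms(1) by (auto simp: unit_simplex_eq)
  then show "x c \<le> y c" "y c \<le> x c"
    using assms(2) by (simp_all add: unit_simplex_subset_iff)
qed

lemma unit_simplex_subset_sub_simplex_iff:
  fixes x m :: "'d::finite \<Rightarrow> nat"
  assumes x: "(\<Sum>c\<in>UNIV. x c) + 1 = n" and m: "(\<Sum>c\<in>UNIV. m c) + k = n" "1 \<le> k"
  shows "unit_simplex x \<subseteq> {p \<in> dilated_simplex n. \<forall>c. real (m c) \<le> p $ c} \<longleftrightarrow> (\<forall>c. m c \<le> x c)"
proof -
  have "unit_simplex x \<subseteq> dilated_simplex n"
    using x by (force simp: unit_simplex_eq dilated_simplex_eq intro: order_trans[of 0 "real _"])
  then have "unit_simplex x \<subseteq> {p \<in> dilated_simplex n. \<forall>c. real (m c) \<le> p $ c} \<longleftrightarrow>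
    unit_simplex x \<subseteq> {p. \<forall>c. real (m c) \<le> p $ c}" by auto
  also have "\<dots> \<longleftrightarrow> (\<forall>c. m c \<le> x c)"
    using x m by (intro unit_simplex_subset_iff) auto
  finally show ?thesis .
qed

lemma pointwise_le_sum_eq_imp_eq:
  fixes m x :: "'d::finite \<Rightarrow> nat"
  assumes "\<forall>c. m c \<le> x c" "(\<Sum>c\<in>UNIV. x c) \<le> (\<Sum>c\<in>UNIV. m c)"
  shows "m = x"
proof (rule ext, rule ccontr)
  fix c assume "m c \<noteq> x c"
  then have "m c < x c" using assms(1) by (simp add: le_neq_implies_less)
  then have "(\<Sum>c\<in>UNIV. m c) < (\<Sum>c\<in>UNIV. x c)" using assms(1) by (intro sum_strict_mono_ex1) auto
  then show False using assms(2) by simp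
qed

section \<open>Spread out collections of three simplices\<close>

text \<open>The sub-simplex of size 2 with corner \<open>e\<^sub>a\<close> contains all three simplices when \<open>a\<close> is a common
  coordinate. In the other direction, the corner of any sub-simplex of size 2 is some \<open>e\<^sub>a\<close>, so it
  misses a simplex whose position is 0 at \<open>a\<close>; a sub-simplex of size 1 contains at most one unit simplex,
  namely itself, and the bound for size 3 is trivial.\<close>

lemma spread_out_3_iff:
  fixes X :: "('d::finite \<Rightarrow> nat) set"
  assumes deg: "\<And>x. x \<in> X \<Longrightarrow> (\<Sum>c\<in>UNIV. x c) = 2" and card: "card X = 3"
  shows "spread_out 3 (unit_simplex ` X :: (real^'d) set set) \<longleftrightarrow> (\<forall>a. \<exists>x\<in>X. x a = 0)"
proof -
  have fin: "finite X" using card by (metis card.infinite zero_neq_numeral)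
  have inj: "inj_on unit_simplex X"
    using deg by (auto intro!: inj_onI intro: unit_simplex_inject)
  have count: "card {S \<in> unit_simplex ` X. S \<subseteq> {p \<in> dilated_simplex 3. \<forall>c. real (m c) \<le> p $ c}}
      = card {x \<in> X. \<forall>c. m c \<le> x c}" if "(\<Sum>c\<in>UNIV. m c) + k = 3" "1 \<le> k" for m k
  proof -
    have "{S \<in> unit_simplex ` X. S \<subseteq> {p \<in> dilated_simplex 3. \<forall>c. real (m c) \<le> p $ c}}
      = unit_simplex ` {x \<in> X. \<forall>c. m c \<le> x c}"
      using unit_simplex_subset_sub_simplex_iff[OF _ that] deg by fastforce
    then show ?thesis using inj by (simp add: card_image inj_on_subset)
  qed
  show ?thesis
  proof
    assume so: "spread_out 3 (unit_simplex ` X :: (real^'d) set set)"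
    show "\<forall>a. \<exists>x\<in>X. x a = 0"
    proof
      fix a :: 'd
      let ?m = "\<lambda>c. of_bool (c = a) :: nat"
      have m: "(\<Sum>c\<in>UNIV. ?m c) + 2 = 3" by (simp add: of_bool_def eval_nat_numeral)
      then have "{p \<in> dilated_simplex 3. \<forall>c. real (?m c) \<le> p $ c} \<in> (sub_simplices 3 2 :: (real^'d) set set)"
        unfolding sub_simplices_def mem_Collect_eq by (intro exI[of _ ?m]) simp
      then have "card {S \<in> unit_simplex ` X. S \<subseteq> {p \<in> dilated_simplex 3. \<forall>c. real (?m c) \<le> p $ c}} \<le> 2"
        using so unfolding spread_out_def by force
      then have "card {x \<in> X. \<forall>c. ?m c \<le> x c} \<le> 2"
        unfolding count[OF m one_le_numeral] .
      then have "{x \<in> X. \<forall>c. ?m c \<le> x c} \<noteq> X"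
        using card by (metis Suc_n_not_le_n eval_nat_numeral(3))
      then show "\<exists>x\<in>X. x a = 0" by (force simp: of_bool_def split: if_splits)
    qed
  next
    assume zero: "\<forall>a. \<exists>x\<in>X. x a = 0"
    show "spread_out 3 (unit_simplex ` X :: (real^'d) set set)"
      unfolding spread_out_def
    proof (intro ballI)
      fix k :: nat and R :: "(real^'d) set"
      assume k: "k \<in> {1..3}" and "R \<in> sub_simplices 3 k"
      then obtain m where m: "(\<Sum>c\<in>UNIV. m c) + k = 3"
        and R: "R = {p \<in> dilated_simplex 3. \<forall>c. real (m c) \<le> p $ c}"
        by (auto simp: sub_simplices_def)
      have "card {x \<in> X. \<forall>c. m c \<le> x c} \<le> k"
      proof -
        consider "k = 3" | "k = 2" | "k = 1" using k by fastforce
        then show ?thesis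
        proof cases
          case 1
          have "card {x \<in> X. \<forall>c. m c \<le> x c} \<le> card X" by (intro card_mono fin) auto
          then show ?thesis using card 1 by linarith
        next
          case 2
          then obtain a where "m a \<noteq> 0" using m by (metis (no_types, lifting) add_0 eq_numeral_extra(2) numeral_eq_iff semiring_norm(89) sum.neutral)
          moreover obtain x where "x \<in> X" "x a = 0" using zero by blast
          ultimately have "{x \<in> X. \<forall>c. m c \<le> x c} \<subset> X" by (metis (mono_tags, lifting) le_zero_eq mem_Collect_eq psubsetI subsetI)
          then have "card {x \<in> X. \<forall>c. m c \<le> x c} < card X" by (rule psubset_card_mono[OF fin])
          then show ?thesis using card 2 by linarith
        next
          case 3
          then have "{x \<in> X. \<forall>c. m c \<le> x c} \<subseteq> {m}"
            using m deg by (auto dest!: pointwise_le_sum_eq_imp_eq)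
          then have "card {x \<in> X. \<forall>c. m c \<le> x c} \<le> card {m}" by (intro card_mono) simp
          then show ?thesis using 3 by simp
        qed
      qed
      then show "card {S \<in> unit_simplex ` X. S \<subseteq> R} \<le> k"
        using count[OF m] k R by simp
    qed
  qed
qed

definition edge_position :: "'d \<Rightarrow> 'd \<Rightarrow> 'd \<Rightarrow> nat" where
  "edge_position i j = (\<lambda>c. of_bool (c = i) + of_bool (c = j))"

lemma sum_edge_position [simp]: "(\<Sum>c\<in>UNIV. edge_position i j c) = 2" for i :: "'d::finite"
  by (simp add: edge_position_def sum.distrib of_bool_def)

lemma position_of_degree_2:
  fixes x :: "'d::finite \<Rightarrow> nat"
  assumes "(\<Sum>c\<in>UNIV. x c) = 2" and "1 \<le> x i"
  obtains j where "x = edge_position i j"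
proof -
  have "(\<Sum>c\<in>UNIV. x c - of_bool (c = i)) = (\<Sum>c\<in>UNIV. x c) - (\<Sum>c\<in>UNIV. of_bool (c = i))"
    using assms(2) by (intro sum_subtractf_nat) auto
  then have s: "(\<Sum>c\<in>UNIV. x c - of_bool (c = i)) = 1" using assms(1) by (simp add: of_bool_def)
  then obtain j where j: "x j - of_bool (j = i) \<noteq> 0" by (metis (no_types, lifting) sum.neutral zero_neq_one)
  have "edge_position i j c \<le> x c" for c using j assms(2) by (auto simp: edge_position_def of_bool_def)
  then have "edge_position i j = x"
    using assms(1) by (intro pointwise_le_sum_eq_imp_eq) auto
  then show ?thesis using that by blast
qed

section \<open>The cell through the barycentre of the hole\<close>

text \<open>The way in which the face condition is used below: the intersection of two cells is a face of
  the first, so it contains both ends of a segment of the first cell as soon as it contains the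
  midpoint.\<close>

lemma midpoint_in_cell:
  assumes "fine_mixed_subdivision n \<C>" "C \<in> \<C>" "P \<in> \<C>"
    and "p \<in> C" "p' \<in> C" "midpoint p p' \<in> P"
  shows "p' \<in> P"
proof (cases "p = p'")
  case False
  have faces: "(D \<inter> E) face_of D" if "D \<in> \<C>" "E \<in> \<C>" for D E
    using assms(1) that by (simp add: fine_mixed_subdivision_def)
  have face: "(C \<inter> P) face_of C" using faces assms by blast
  have conv: "convex C" using faces[of C C] assms(2) face_of_imp_convex by force
  have seg: "midpoint p p' \<in> open_segment p p'" using False by (simp add: midpoint_in_open_segment)
  moreover have "midpoint p p' \<in> C"
    using conv seg assms(4,5) by (meson convex_contains_open_segment subsetD)
  ultimately show ?thesis using face_ofD[OF face] assms by blast
qed (use assms in simp)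



text \<open>No entry exceeds \<open>2/3\<close>, so each of the two rows has at least two positive entries among the
  three; they share a column, and their other entries can be chosen in the other two columns
  because every column is covered.\<close>

lemma two_rows_meet: fixes u v :: "'a \<Rightarrow> real"
  assumes "\<And>c. 0 \<le> u c" "\<And>c. 0 \<le> v c"
   "u i + v i = 2/3" "u j + v j = 2/3" "u k + v k = 2/3"
   "u i + u j + u k = 1" "v i+v j+v k = 1"
 shows "\<exists>x y z. {x, y, z} = {i, j, k} \<and> 0 < u x \<and> 0 < v x \<and> 0 < u y \<and> 0 < v z"
proof -
  have "(u i>0\<and>v i>0\<and>((u j>0\<and>v k>0)\<or>(u k>0\<and>v j>0))) \<or> (u j>0\<and>v j>0\<and>((u i>0\<and>v k>0)\<or>(u k>0\<and>v i>0))) \<or> (u k>0\<and>v k>0\<and>((u j>0\<and>v i>0)\<or>(u i>0\<and>v j>0)))"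
    using assms(3-) assms(1)[of i] assms(1)[of j] assms(1)[of k] assms(2)[of i] assms(2)[of j] assms(2)[of k] by (smt (verit))
  moreover have "0 < u x \<and> 0 < v x \<and> 0 < u y \<and> 0 < v z \<Longrightarrow> ?thesis" if "{x, y, z} = {i, j, k}" for x y z
    using that by blast
  note this[of i j k] this[of i k j] this[of j i k] this[of j k i] this[of k i j] this[of k j i]
  ultimately show ?thesis by (auto simp only: insert_commute)
qed

text \<open>Hall's theorem for three rows and three columns: no row is zero, all columns are
  covered, and two rows cannot be supported in a single column, as the remaining row would have to supply \<open>4/3\<close> to the other two.\<close>

lemma three_rows_matching: fixes u v w :: "'a \<Rightarrow> real"
  assumes nonneg: "\<And>c. 0 \<le> u c" "\<And>c. 0 \<le> v c" "\<And>c. 0 \<le> w c"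
   and "u i + v i + w i= 2/3" "u j + v j +w j= 2/3" "u k + v k + w k= 2/3"
   "u i + u j + u k \<le> 1" "v i+v j+v k \<le> 1" "w i+w j+w k \<le> 1"
   "u i + u j + u k >0" "v i+v j+v k >0" "w i+w j+w k >0"
 shows "\<exists>x y z. {x, y, z} = {i, j, k} \<and> 0 < u x \<and> 0 < v y \<and> 0 < w z"
proof -
  note facts = assms(4-) nonneg[of i] nonneg[of j] nonneg[of k]
  have rows: "0 < u i \<or> 0 < u j \<or> 0 < u k" "0 < v i \<or> 0 < v j \<or> 0 < v k" "0 < w i \<or> 0 < w j \<or> 0 < w k"
    and cols: "0 < u i \<or> 0 < v i \<or> 0 < w i" "0 < u j \<or> 0 < v j \<or> 0 < w j" "0 < u k \<or> 0 < v k \<or> 0 < w k"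
    using facts by linarith+
  have pairs: "0 < u j \<or> 0 < u k \<or> 0 < v j \<or> 0 < v k" "0 < u i \<or> 0 < u k \<or> 0 < v i \<or> 0 < v k"
    "0 < u i \<or> 0 < u j \<or> 0 < v i \<or> 0 < v j"
    "0 < u j \<or> 0 < u k \<or> 0 < w j \<or> 0 < w k" "0 < u i \<or> 0 < u k \<or> 0 < w i \<or> 0 < w k"
    "0 < u i \<or> 0 < u j \<or> 0 < w i \<or> 0 < w j"
    "0 < w j \<or> 0 < w k \<or> 0 < v j \<or> 0 < v k" "0 < w i \<or> 0 < w k \<or> 0 < v i \<or> 0 < v k"
    "0 < w i \<or> 0 < w j \<or> 0 < v i \<or> 0 < v j"
    using facts by linarith+
  have "0<u i \<and> 0<v j \<and> 0<w k \<or> 0<u i \<and> 0<v k \<and> 0<w j \<or> 0<u j \<and> 0<v i \<and> 0<w k \<or> 0<u j \<and> 0<v k \<and> 0<w i \<or> 0<u k \<and> 0<v i \<and> 0<w j \<or> 0<u k \<and> 0<v j \<and> 0<w i"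
    using rows cols pairs by argo
  moreover have "0 < u x \<and> 0 < v y \<and> 0 < w z \<Longrightarrow> ?thesis" if "{x, y, z} = {i, j, k}" for x y z
    using that by blast
  note this[of i j k] this[of i k j] this[of j i k] this[of j k i] this[of k i j] this[of k j i]
  ultimately show ?thesis by (auto simp only: insert_commute)
qed


text \<open>Supports of three summands from which two lattice points \<open>p\<close>, \<open>p'\<close> of a cell can be read off
  that contradict the face condition. In the first alternative they are \<open>p = 2e\<^sub>x + e\<^sub>a\<close> and
  \<open>p' = e\<^sub>y + e\<^sub>z + e\<^sub>a\<close>, in the second one \<open>p = 2e\<^sub>a + e\<^sub>x\<close> and \<open>p' = e\<^sub>y + e\<^sub>z + e\<^sub>x\<close>. In both cases
  the midpoint is \<open>e\<^sub>a + e\<^sub>x + (e\<^sub>y + e\<^sub>z)/2\<close>, which lies in the unit simplex at \<open>e\<^sub>a + e\<^sub>x\<close>.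
  The second alternative excludes \<open>a \<in> T\<close>, since \<open>p'\<close> lies in that simplex too if \<open>a\<close> is \<open>y\<close> or
  \<open>z\<close>.\<close>

definition crossing :: "'a \<Rightarrow> 'a set \<Rightarrow> ('a \<Rightarrow> real) \<Rightarrow> ('a \<Rightarrow> real) \<Rightarrow> ('a \<Rightarrow> real) \<Rightarrow> bool" where
  "crossing a T f g h \<longleftrightarrow> (\<exists>x y z. {x, y, z} = T \<and> 0 < f y \<and> 0 < g z \<and>
     (0 < f x \<and> 0 < g x \<and> 0 < h a \<or> a \<notin> T \<and> 0 < f a \<and> 0 < g a \<and> 0 < h x))"

lemma crossingI_meet:
  assumes "{x, y, z} = T" "0 < f x" "0 < g x" "0 < f y" "0 < g z" "0 < h a"
  shows "crossing a T f g h"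
  unfolding crossing_def using assms by (intro exI[of _ x] exI[of _ y] exI[of _ z]) simp

lemma crossingI_matching:
  assumes "{x, y, z} = T" "a \<notin> T" "0 < h x" "0 < f y" "0 < g z" "0 < f a" "0 < g a"
  shows "crossing a T f g h"
  unfolding crossing_def using assms by (intro exI[of _ x] exI[of _ y] exI[of _ z]) simp

text \<open>A summand that is the vertex \<open>e\<^sub>a\<close> leaves two rows that have to supply \<open>2/3\<close> to each of the
  three columns.\<close>

lemma crossing_of_full_row:
  assumes "\<And>c. 0 \<le> u c" "\<And>c. 0 \<le> v c" "0 < w a"
   "u i + v i = 2/3" "u j + v j = 2/3" "u k + v k = 2/3"
   "u i + u j + u k = 1" "v i+v j+v k = 1"
  shows "crossing a {i, j, k} u v w"
proof -
  obtain x y z where "{x, y, z} = {i, j, k}" "0 < u x" "0 < v x" "0 < u y" "0 < v z"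
    using two_rows_meet[of u v i j k] assms by auto
  then show ?thesis using assms(3) by (intro crossingI_meet[of x y z])
qed

lemma crossing_of_full_row_if_notin:
  fixes u v w :: "'a \<Rightarrow> real"
  assumes nonneg: "\<And>c. 0 \<le> u c" "\<And>c. 0 \<le> v c" "\<And>c. 0 \<le> w c"
    and row: "u a + u i + u j + u k = 1" "v a + v i + v j + v k = 1" "w a + w i + w j + w k = 1"
    and col: "u a + v a + w a = 1" "u i + v i + w i = 2/3" "u j + v j + w j = 2/3" "u k + v k + w k = 2/3"
    and full: "w a = 1"
  shows "crossing a {i, j, k} u v w"
proof -
  have "w i = 0" "w j = 0" "w k = 0"
    using full row(3) nonneg(3)[of i] nonneg(3)[of j] nonneg(3)[of k] by linarith+
  moreover have "u a = 0" "v a = 0" using full col(1) nonneg(1,2)[of a] by linarith+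
  ultimately show ?thesis using row col full by (intro crossing_of_full_row nonneg) simp_all
qed

text \<open>The matrix of the decomposition of \<open>q\<close> when \<open>a\<close> is different from \<open>i\<close>, \<open>j\<close>, \<open>k\<close>. If no row is
  the vertex \<open>e\<^sub>a\<close>, at least two rows are positive at \<open>a\<close> and there is a perfect matching
  of the rows with the other three columns, which gives the second alternative of a crossing.\<close>

lemma crossing_exists_if_notin:
  fixes u v w :: "'a \<Rightarrow> real"
  assumes nonneg: "\<And>c. 0 \<le> u c" "\<And>c. 0 \<le> v c" "\<And>c. 0 \<le> w c"
    and a: "a \<notin> {i, j, k}"
    and row: "u a + u i + u j + u k = 1" "v a + v i + v j + v k = 1" "w a + w i + w j + w k = 1"
    and col: "u a + v a + w a = 1" "u i + v i + w i = 2/3" "u j + v j + w j = 2/3" "u k + v k + w k = 2/3"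
  shows "crossing a {i, j, k} u v w \<or> crossing a {i, j, k} v w u \<or> crossing a {i, j, k} w u v"
proof -
  note facts = row col nonneg[of a] nonneg[of i] nonneg[of j] nonneg[of k]
  consider "w a = 1" | "u a = 1" | "v a = 1" | "u a \<noteq> 1" "v a \<noteq> 1" "w a \<noteq> 1" by blast
  then show ?thesis
  proof cases
    case 1
    then have "crossing a {i, j, k} u v w" using row col by (intro crossing_of_full_row_if_notin nonneg) simp_all
    then show ?thesis by blast
  next
    case 2
    then have "crossing a {i, j, k} v w u" using row col by (intro crossing_of_full_row_if_notin nonneg) simp_all
    then show ?thesis by blast
  next
    case 3
    then have "crossing a {i, j, k} w u v" using row col by (intro crossing_of_full_row_if_notin nonneg) simp_all
    then show ?thesis by blast
  next
    case 4
    then have "u a < 1" "v a < 1" "w a < 1" using facts by linarith+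
    then have "\<exists>x y z. {x, y, z} = {i, j, k} \<and> 0 < u x \<and> 0 < v y \<and> 0 < w z"
      using facts by (intro three_rows_matching nonneg) linarith+
    then obtain x y z where xyz: "{x, y, z} = {i, j, k}" "0 < u x" "0 < v y" "0 < w z" by blast
    have "0 < u a \<and> 0 < v a \<or> 0 < v a \<and> 0 < w a \<or> 0 < w a \<and> 0 < u a"
      using facts 4 by linarith
    then consider "0 < u a" "0 < v a" | "0 < v a" "0 < w a" | "0 < w a" "0 < u a" by blast
    then show ?thesis
    proof cases
      case 1
      have "{z, x, y} = {i, j, k}" using xyz(1) by blast
      then have "crossing a {i, j, k} u v w" using 1 xyz a by (intro crossingI_matching[of z x y])
      then show ?thesis by blast
    next
      case 2
      then have "crossing a {i, j, k} v w u" using xyz a by (intro crossingI_matching[of x y z])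
      then show ?thesis by blast
    next
      case 3
      have "{y, z, x} = {i, j, k}" using xyz(1) by blast
      then have "crossing a {i, j, k} w u v" using 3 xyz a by (intro crossingI_matching[of y z x])
      then show ?thesis by blast
    qed
  qed
qed

text \<open>The row \<open>w\<close> without \<open>a\<close> must be positive in both other columns, and one of them also occurs in
  the row \<open>u\<close>; there the two rows meet, and \<open>v\<close> supplies \<open>a\<close>.\<close>

lemma crossing_of_missing_row:
  fixes u v w :: "'a \<Rightarrow> real"
  assumes nonneg: "\<And>c. 0 \<le> u c" "\<And>c. 0 \<le> v c" "\<And>c. 0 \<le> w c"
    and row: "u a + u j + u k = 1" "v a + v j + v k = 1" "w a + w j + w k = 1"
    and col: "u a + v a + w a = 5/3" "u j + v j + w j = 2/3" "u k + v k + w k = 2/3"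
    and w: "w a = 0" and lt: "u a \<noteq> 1" "v a \<noteq> 1"
  shows "crossing a {a, j, k} w u v"
proof -
  note facts = row col w lt nonneg[of a] nonneg[of j] nonneg[of k]
  have p: "0 < u a" "0 < v a" "0 < w j" "0 < w k" using facts by linarith+
  have "0 < u j \<or> 0 < u k" using facts by linarith
  then show ?thesis
  proof
    assume "0 < u j"
    moreover have "{j, k, a} = {a, j, k}" by blast
    ultimately show ?thesis using p by (intro crossingI_meet[of j k a])
  next
    assume "0 < u k"
    moreover have "{k, j, a} = {a, j, k}" by blast
    ultimately show ?thesis using p by (intro crossingI_meet[of k j a])
  qed
qed

lemma crossing_of_full_row_if_in:
  fixes u v w :: "'a \<Rightarrow> real"
  assumes nonneg: "\<And>c. 0 \<le> u c" "\<And>c. 0 \<le> v c" "\<And>c. 0 \<le> w c"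
    and row: "u a + u j + u k = 1" "v a + v j + v k = 1" "w a + w j + w k = 1"
    and col: "u a + v a + w a = 5/3" "u j + v j + w j = 2/3" "u k + v k + w k = 2/3"
    and full: "w a = 1"
  shows "crossing a {a, j, k} u v w"
proof -
  have "w j = 0" "w k = 0"
    using full row(3) nonneg(3)[of j] nonneg(3)[of k] by linarith+
  then show ?thesis using row col full by (intro crossing_of_full_row nonneg) simp_all
qed

text \<open>The matrix of the decomposition of \<open>q\<close> when \<open>a\<close> is one of the three, so that its column sum
  is \<open>5/3\<close>. If all rows are positive at \<open>a\<close> but none is the vertex \<open>e\<^sub>a\<close>, the columns \<open>j\<close>
  and \<open>k\<close> are positive in two different rows.\<close>

lemma crossing_exists_if_in:
  fixes u v w :: "'a \<Rightarrow> real"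
  assumes nonneg: "\<And>c. 0 \<le> u c" "\<And>c. 0 \<le> v c" "\<And>c. 0 \<le> w c"
    and row: "u a + u j + u k = 1" "v a + v j + v k = 1" "w a + w j + w k = 1"
    and col: "u a + v a + w a = 5/3" "u j + v j + w j = 2/3" "u k + v k + w k = 2/3"
  shows "crossing a {a, j, k} u v w \<or> crossing a {a, j, k} v w u \<or> crossing a {a, j, k} w u v"
proof -
  note facts = row col nonneg[of a] nonneg[of j] nonneg[of k]
  consider "w a = 1" | "u a = 1" | "v a = 1" | "u a \<noteq> 1" "v a \<noteq> 1" "w a \<noteq> 1" by blast
  then show ?thesis
  proof cases
    case 1
    then have "crossing a {a, j, k} u v w" using row col by (intro crossing_of_full_row_if_in nonneg) simp_all
    then show ?thesis by blast
  next
    case 2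
    then have "crossing a {a, j, k} v w u" using row col by (intro crossing_of_full_row_if_in nonneg) simp_all
    then show ?thesis by blast
  next
    case 3
    then have "crossing a {a, j, k} w u v" using row col by (intro crossing_of_full_row_if_in nonneg) simp_all
    then show ?thesis by blast
  next
    case 4
    consider "u a = 0" | "v a = 0" | "w a = 0" | "0 < u a" "0 < v a" "0 < w a"
      using nonneg[of a] by linarith
    then show ?thesis
    proof cases
      case 1
      then have "crossing a {a, j, k} u v w"
        using row col 4 by (intro crossing_of_missing_row nonneg) simp_all
      then show ?thesis by blast
    next
      case 2
      then have "crossing a {a, j, k} v w u"
        using row col 4 by (intro crossing_of_missing_row nonneg) simp_all
      then show ?thesis by blast
    next
      case 3
      then have "crossing a {a, j, k} w u v"
        using row col 4 by (intro crossing_of_missing_row nonneg) simp_all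
      then show ?thesis by blast
    next
      case 5: 4
      have pos: "0 < u j \<or> 0 < u k" "0 < v j \<or> 0 < v k" "0 < w j \<or> 0 < w k"
        "0 < u j \<or> 0 < v j \<or> 0 < w j" "0 < u k \<or> 0 < v k \<or> 0 < w k"
        using facts 4 by linarith+
      have c: "crossing a {a, j, k} f g h"
        if "0 < f a" "0 < g a" "0 < h a" "0 < f j \<and> 0 < g k \<or> 0 < f k \<and> 0 < g j" for f g h :: "'a \<Rightarrow> real"
        using that crossingI_meet[of a j k "{a, j, k}" f g h a] crossingI_meet[of a k j "{a, j, k}" f g h a]
        by (auto simp: insert_commute)
      show ?thesis using c[of u v w] c[of v w u] c[of w u v] 5 pos by argo
    qed
  qed
qed

lemma sum_vertex [simp]: "(\<Sum>c\<in>UNIV. vertex i $ c) = (1::real)" for i :: "'d::finite"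
  by (simp add: axis_def)

lemma vertex_nth: "vertex i $ c = of_bool (c = i)"
  by (simp add: axis_def)

lemma not_crossing_in_cell:
  fixes F G H :: "(real^'d) set"
  assumes sub: "fine_mixed_subdivision 3 \<C>" and cell: "F + G + H \<in> \<C>"
    and face: "F face_of std_simplex" "G face_of std_simplex" "H face_of std_simplex"
    and mem: "f \<in> F" "g \<in> G" "h \<in> H"
    and T: "card T = 3" "\<And>x. x \<in> T \<Longrightarrow> unit_simplex (edge_position a x) \<in> \<C>"
  shows "\<not> crossing a T (($) f) (($) g) (($) h)"
proof
  assume "crossing a T (($) f) (($) g) (($) h)"
  then obtain x y z where xyz: "{x, y, z} = T" and yz: "0 < f $ y" "0 < g $ z"
    and alt: "0 < f $ x \<and> 0 < g $ x \<and> 0 < h $ a \<or> a \<notin> T \<and> 0 < f $ a \<and> 0 < g $ a \<and> 0 < h $ x"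
    by (auto simp: crossing_def)
  have ne: "x \<noteq> y" "x \<noteq> z" using xyz T(1) by (auto simp: card_insert_if split: if_splits)
  have lattice: "vertex r + vertex s + vertex t \<in> F + G + H" if "0 < f $ r" "0 < g $ s" "0 < h $ t" for r s t
    using that mem face vertex_in_face_of_simplex by (intro set_plus_intro) blast+
  have P: "unit_simplex (edge_position a x) \<in> \<C>" using xyz T(2) by blast
  note mid = midpoint_in_cell[OF sub cell P]
  from alt show False
  proof (elim disjE conjE)
    assume pos: "0 < f $ x" "0 < g $ x" "0 < h $ a"
    have "midpoint (vertex x + vertex x + vertex a) (vertex y + vertex z + vertex a) \<in> unit_simplex (edge_position a x)"
      by (auto simp: unit_simplex_eq midpoint_def edge_position_def vertex_nth sum.distrib simp flip: sum_divide_distrib)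
    then have "vertex y + vertex z + vertex a \<in> unit_simplex (edge_position a x)"
      using mid lattice pos yz by blast
    then have "real (edge_position a x x) \<le> (vertex y + vertex z + vertex a) $ x"
      unfolding unit_simplex_eq by blast
    then show False using ne by (simp add: edge_position_def vertex_nth)
  next
    assume a: "a \<notin> T" and pos: "0 < f $ a" "0 < g $ a" "0 < h $ x"
    have "midpoint (vertex a + vertex a + vertex x) (vertex y + vertex z + vertex x) \<in> unit_simplex (edge_position a x)"
      by (auto simp: unit_simplex_eq midpoint_def edge_position_def vertex_nth sum.distrib simp flip: sum_divide_distrib)
    then have "vertex y + vertex z + vertex x \<in> unit_simplex (edge_position a x)"
      using mid lattice pos yz by blast
    then have "real (edge_position a x a) \<le> (vertex y + vertex z + vertex x) $ a"
      unfolding unit_simplex_eq by blast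
    then show False using a xyz by (auto simp: edge_position_def vertex_nth)
  qed
qed

lemma extends_imp_no_common_coordinate:
  fixes X :: "('d::finite \<Rightarrow> nat) set"
  assumes sub: "fine_mixed_subdivision 3 \<C>" and X: "unit_simplex ` X \<subseteq> \<C>"
    and deg: "\<And>x. x \<in> X \<Longrightarrow> (\<Sum>c\<in>UNIV. x c) = 2" and card: "card X = 3"
  shows "\<exists>x\<in>X. x a = 0"
proof (rule ccontr)
  assume "\<not> (\<exists>x\<in>X. x a = 0)"
  then have common: "\<exists>i. x = edge_position a i" if "x \<in> X" for x
    using position_of_degree_2[OF deg[OF that], of a] that by (metis less_one not_less)
  obtain x0 x1 x2 where X_eq: "X = {x0, x1, x2}" and ne: "x0 \<noteq> x1" "x1 \<noteq> x2" "x0 \<noteq> x2"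
    using card by (auto simp: card_3_iff)
  obtain i j k where pos: "x0 = edge_position a i" "x1 = edge_position a j" "x2 = edge_position a k"
    using common X_eq by (metis insertCI)
  then have ijk: "i \<noteq> j" "j \<noteq> k" "i \<noteq> k" using ne by auto
  let ?T = "{i, j, k}"
  have T: "card ?T = 3" "\<And>x. x \<in> ?T \<Longrightarrow> unit_simplex (edge_position a x) \<in> \<C>"
    using ijk X X_eq pos by auto
  \<comment> \<open>The barycentre of the hole, whose corners are \<open>e\<^sub>a + e\<^sub>i + e\<^sub>j\<close>, \<open>e\<^sub>a + e\<^sub>j + e\<^sub>k\<close> and \<open>e\<^sub>a + e\<^sub>i + e\<^sub>k\<close>.\<close>
  define q :: "real^'d" where "q = vertex a + (2/3) *\<^sub>R (vertex i + vertex j + vertex k)"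
  have q_nth: "q $ c = of_bool (c = a) + 2/3 * of_bool (c \<in> ?T)" for c
    using ijk by (auto simp: q_def vertex_nth)
  have "(\<Sum>c\<in>UNIV. q $ c) = 3"
    by (simp add: q_def sum.distrib flip: sum_distrib_left sum_divide_distrib)
  then have "q \<in> dilated_simplex 3" by (auto simp: dilated_simplex_eq q_nth)
  moreover have "\<Union>\<C> = dilated_simplex 3" using sub by (simp add: fine_mixed_subdivision_def)
  ultimately obtain C where C: "C \<in> \<C>" "q \<in> C" by blast
  have "fine_mixed_cell 3 C" using sub C(1) by (simp add: fine_mixed_subdivision_def)
  then obtain B where B: "\<And>l::nat. l < 3 \<Longrightarrow> B l face_of std_simplex" and C_sum: "C = (\<Sum>l<3. B l)"
    unfolding fine_mixed_cell_def by blast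
  have C_eq: "C = B 0 + B 1 + B 2" unfolding C_sum by (simp add: eval_nat_numeral)
  obtain f g h where mem: "f \<in> B 0" "g \<in> B 1" "h \<in> B 2" and q: "q = f + g + h"
    using C(2) unfolding C_eq by (auto elim!: set_plus_elim)
  have simplex: "f \<in> coord_face UNIV" "g \<in> coord_face UNIV" "h \<in> coord_face UNIV"
    using mem face_of_imp_subset[OF B[of 0]] face_of_imp_subset[OF B[of 1]] face_of_imp_subset[OF B[of 2]]
    by (auto simp: std_simplex_eq_coord_face)
  then have nonneg: "0 \<le> f $ c" "0 \<le> g $ c" "0 \<le> h $ c" for c by (auto simp: coord_face_def)
  have col: "f $ c + g $ c + h $ c = of_bool (c = a) + 2/3 * of_bool (c \<in> ?T)" for c
    using q_nth[of c] q by simp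
  have zero: "f $ c = 0" "g $ c = 0" "h $ c = 0" if "c \<notin> insert a ?T" for c
    using col[of c] nonneg[of c] that by auto
  have row: "(\<Sum>c\<in>insert a ?T. r $ c) = 1" if "r \<in> {f, g, h}" for r
  proof -
    have "(\<Sum>c\<in>insert a ?T. r $ c) = (\<Sum>c\<in>UNIV. r $ c)"
      using that zero by (intro sum.mono_neutral_left) auto
    then show ?thesis using that simplex by (auto simp: coord_face_def)
  qed
  have "crossing a ?T (($) f) (($) g) (($) h) \<or> crossing a ?T (($) g) (($) h) (($) f)
      \<or> crossing a ?T (($) h) (($) f) (($) g)"
  proof (cases "a \<in> ?T")
    case False
    then show ?thesis
      using ijk row[of f] row[of g] row[of h] col[of a] col[of i] col[of j] col[of k]
      by (intro crossing_exists_if_notin nonneg) auto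
  next
    case True
    then obtain j' k' where T': "?T = {a, j', k'}" "a \<noteq> j'" "a \<noteq> k'" "j' \<noteq> k'"
      using ijk by (metis insertE insert_commute singletonD)
    show ?thesis
      using T'(2-) row[of f] row[of g] row[of h] col[of a] col[of j'] col[of k']
      unfolding T'(1) by (intro crossing_exists_if_in nonneg) auto
  qed
  moreover have faces: "B 0 face_of std_simplex" "B 1 face_of std_simplex" "B 2 face_of std_simplex"
    using B by auto
  moreover have "B 0 + B 1 + B 2 \<in> \<C>" "B 1 + B 2 + B 0 \<in> \<C>" "B 2 + B 0 + B 1 \<in> \<C>"
    using C(1) C_eq by (simp_all add: ac_simps)
  ultimately show False
    using not_crossing_in_cell[OF sub _ _ _ _ _ _ _ T] mem by blast
qed

section \<open>Regular cells\<close>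

definition slack_min :: "real^'d \<Rightarrow> real^'d \<Rightarrow> real" where
  "slack_min w y = Min (range (\<lambda>c. w $ c - y $ c))"

definition tight :: "real^'d \<Rightarrow> real^'d \<Rightarrow> 'd set" where
  "tight w y = {c. w $ c - y $ c = slack_min w y}"

lemma slack_min_le: "slack_min w y \<le> w $ c - y $ c"
  by (simp add: slack_min_def)

lemma tight_nonempty: "tight w y \<noteq> {}"
proof -
  have "slack_min w y \<in> range (\<lambda>c. w $ c - y $ c)"
    unfolding slack_min_def by (intro Min_in) auto
  then show ?thesis by (auto simp: tight_def)
qed

lemma slack_min_less: "c \<notin> tight w y \<Longrightarrow> slack_min w y < w $ c - y $ c"
  using slack_min_le[of w y c] by (auto simp: tight_def)

text \<open>The difference of the two sides is the average of the nonnegative slacks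
  \<open>w c - y c - slack_min w y\<close> with weights \<open>b c\<close>.\<close>

lemma slack_min_plus_inner_le:
  fixes b :: "real^'d"
  assumes b: "b \<in> coord_face UNIV"
  shows "slack_min w y + y \<bullet> b \<le> w \<bullet> b"
    and "slack_min w y + y \<bullet> b = w \<bullet> b \<longleftrightarrow> b \<in> coord_face (tight w y)"
proof -
  let ?t = "\<lambda>c. b $ c * (w $ c - y $ c - slack_min w y)"
  have one: "(\<Sum>c\<in>UNIV. b $ c) = 1" and nonneg: "0 \<le> b $ c" for c
    using b by (auto simp: coord_face_def)
  have "(\<Sum>c\<in>UNIV. ?t c) = (\<Sum>c\<in>UNIV. w $ c * b $ c - y $ c * b $ c - slack_min w y * b $ c)"
    by (intro sum.cong) (auto simp: algebra_simps)
  also have "\<dots> = w \<bullet> b - y \<bullet> b - slack_min w y"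
    using one by (simp add: sum_subtractf inner_vec_def flip: sum_distrib_left)
  finally have sum: "(\<Sum>c\<in>UNIV. ?t c) = w \<bullet> b - y \<bullet> b - slack_min w y" .
  have t: "0 \<le> ?t c" for c using nonneg slack_min_le[of w y c] by simp
  then show "slack_min w y + y \<bullet> b \<le> w \<bullet> b" using sum sum_nonneg[of UNIV ?t] by simp
  have "slack_min w y + y \<bullet> b = w \<bullet> b \<longleftrightarrow> (\<Sum>c\<in>UNIV. ?t c) = 0" using sum by auto
  also have "\<dots> \<longleftrightarrow> (\<forall>c. ?t c = 0)" using t by (simp add: sum_nonneg_eq_0_iff)
  also have "\<dots> \<longleftrightarrow> b \<in> coord_face (tight w y)"
    using one nonneg by (auto simp: coord_face_def tight_def)
  finally show "slack_min w y + y \<bullet> b = w \<bullet> b \<longleftrightarrow> b \<in> coord_face (tight w y)" .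
qed

definition regular_cell :: "nat \<Rightarrow> (nat \<Rightarrow> real^'d) \<Rightarrow> real^'d \<Rightarrow> (real^'d) set" where
  "regular_cell n W y = (\<Sum>l<n. coord_face (tight (W l) y))"

lemma mem_Minkowski_sum_iff:
  fixes S :: "nat \<Rightarrow> 'a::comm_monoid_add set"
  shows "x \<in> (\<Sum>l<n. S l) \<longleftrightarrow> (\<exists>b. (\<forall>l<n. b l \<in> S l) \<and> x = (\<Sum>l<n. b l))"
  by (auto simp: set_sum_alt)

lemma coord_face_mono: "I \<subseteq> J \<Longrightarrow> coord_face I \<subseteq> coord_face J"
  by (auto simp: coord_face_def)

lemma Minkowski_sum_coord_face_hull:
  "(\<Sum>l<n. coord_face (I l)) = convex hull (\<Sum>l<n. vertex ` I l)"
  by (simp add: coord_face_eq_hull convex_hull_set_sum)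

lemma convex_compact_Minkowski_sum:
  "convex (\<Sum>l<n. coord_face (I l) :: (real^'d) set)" "compact (\<Sum>l<n. coord_face (I l) :: (real^'d) set)"
  by (simp_all add: Minkowski_sum_coord_face_hull finite_imp_compact_convex_hull finite_set_sum)

text \<open>The objective of the linear program dual to the transport problem of writing \<open>x\<close> as a sum of \<open>n\<close>
  points \<open>b l\<close> of the standard simplex at cost \<open>\<Sum>l<n. W l \<bullet> b l\<close>.\<close>

definition dual_value :: "nat \<Rightarrow> (nat \<Rightarrow> real^'d) \<Rightarrow> real^'d \<Rightarrow> real^'d \<Rightarrow> real" where
  "dual_value n W x y = y \<bullet> x + (\<Sum>l<n. slack_min (W l) y)"

text \<open>Weak duality and complementary slackness.\<close>

lemma dual_value_le_cost:
  fixes b :: "nat \<Rightarrow> real^'d"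
  assumes b: "\<forall>l<n. b l \<in> coord_face UNIV"
  shows "dual_value n W (\<Sum>l<n. b l) y \<le> (\<Sum>l<n. W l \<bullet> b l)"
    and "dual_value n W (\<Sum>l<n. b l) y = (\<Sum>l<n. W l \<bullet> b l) \<longleftrightarrow> (\<forall>l<n. b l \<in> coord_face (tight (W l) y))"
proof -
  let ?t = "\<lambda>l. W l \<bullet> b l - (slack_min (W l) y + y \<bullet> b l)"
  have sum: "(\<Sum>l<n. ?t l) = (\<Sum>l<n. W l \<bullet> b l) - dual_value n W (\<Sum>l<n. b l) y"
    by (simp add: dual_value_def sum_subtractf sum.distrib inner_sum_right)
  have t: "0 \<le> ?t l" if "l < n" for l using slack_min_plus_inner_le(1)[of "b l"] b that by simp
  then show "dual_value n W (\<Sum>l<n. b l) y \<le> (\<Sum>l<n. W l \<bullet> b l)"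
    using sum sum_nonneg[of "{..<n}" ?t] by simp
  have "dual_value n W (\<Sum>l<n. b l) y = (\<Sum>l<n. W l \<bullet> b l) \<longleftrightarrow> (\<Sum>l<n. ?t l) = 0" using sum by auto
  also have "\<dots> \<longleftrightarrow> (\<forall>l<n. ?t l = 0)" using t by (subst sum_nonneg_eq_0_iff) auto
  also have "\<dots> \<longleftrightarrow> (\<forall>l<n. b l \<in> coord_face (tight (W l) y))"
  proof -
    have "?t l = 0 \<longleftrightarrow> b l \<in> coord_face (tight (W l) y)" if "l < n" for l
      using slack_min_plus_inner_le(2)[of "b l" "W l" y] b that by auto
    then show ?thesis by blast
  qed
  finally show "dual_value n W (\<Sum>l<n. b l) y = (\<Sum>l<n. W l \<bullet> b l) \<longleftrightarrow> (\<forall>l<n. b l \<in> coord_face (tight (W l) y))" .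
qed

text \<open>On the cell of \<open>y\<close> the affine function \<open>\<lambda>x. dual_value n W x y\<close> is the minimal cost, hence it
  dominates the affine functions of all other \<open>y'\<close>, with equality exactly where the cells meet.\<close>

lemma regular_cell_dual_optimal:
  assumes x: "x \<in> regular_cell n W y"
  shows "dual_value n W x y' \<le> dual_value n W x y"
    and "x \<in> regular_cell n W y' \<longleftrightarrow> dual_value n W x y' = dual_value n W x y"
proof -
  have le: "dual_value n W x y' \<le> dual_value n W x y \<and>
      (dual_value n W x y' = dual_value n W x y \<longrightarrow> x \<in> regular_cell n W y')"
    if asm: "x \<in> regular_cell n W y" for y y'
  proof -
    obtain b where b: "\<forall>l<n. b l \<in> coord_face (tight (W l) y)" and x: "x = (\<Sum>l<n. b l)"
      using asm by (auto simp: regular_cell_def mem_Minkowski_sum_iff)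
    then have U: "\<forall>l<n. b l \<in> coord_face UNIV" using coord_face_mono by blast
    have "dual_value n W x y = (\<Sum>l<n. W l \<bullet> b l)" using dual_value_le_cost(2)[OF U] b x by blast
    then show ?thesis
      using dual_value_le_cost[OF U, of W y'] x by (auto simp: regular_cell_def mem_Minkowski_sum_iff)
  qed
  show "dual_value n W x y' \<le> dual_value n W x y" using le x by blast
  show "x \<in> regular_cell n W y' \<longleftrightarrow> dual_value n W x y' = dual_value n W x y"
    using le[of y y'] le[of y' y] x by force
qed

lemma regular_cell_Int_face_of:
  "(regular_cell n W y \<inter> regular_cell n W y') face_of regular_cell n W y"
proof -
  let ?r = "(\<Sum>l<n. slack_min (W l) y') - (\<Sum>l<n. slack_min (W l) y)"
  have ge: "?r \<le> (y - y') \<bullet> x" if "x \<in> regular_cell n W y" for x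
    using regular_cell_dual_optimal(1)[OF that, of y'] by (simp add: dual_value_def inner_diff_left)
  have "regular_cell n W y \<inter> regular_cell n W y' = regular_cell n W y \<inter> {x. (y - y') \<bullet> x = ?r}"
    using regular_cell_dual_optimal(2)[of _ n W y y'] by (auto simp: dual_value_def inner_diff_left)
  moreover have "convex (regular_cell n W y)"
    unfolding regular_cell_def by (rule convex_compact_Minkowski_sum)
  ultimately show ?thesis using ge by (simp add: face_of_Int_supporting_hyperplane_ge)
qed

lemma finite_regular_cells: "finite (range (regular_cell n W))"
proof -
  let ?F = "(\<lambda>I. \<Sum>l<n. coord_face (I l)) ` (PiE {..<n} (\<lambda>_. UNIV))"
  have "regular_cell n W y \<in> ?F" for y
    by (intro image_eqI[where x="\<lambda>l\<in>{..<n}. tight (W l) y"]) (auto simp: regular_cell_def)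
  then have "range (regular_cell n W) \<subseteq> ?F" by (rule image_subsetI)
  moreover have "finite ?F" by (intro finite_imageI finite_PiE) auto
  ultimately show ?thesis by (rule finite_subset)
qed

lemma regular_cell_subset: "regular_cell n W y \<subseteq> dilated_simplex n"
proof
  fix x assume "x \<in> regular_cell n W y"
  then obtain b where b: "\<forall>l<n. b l \<in> coord_face (tight (W l) y)" and x: "x = (\<Sum>l<n. b l)"
    by (auto simp: regular_cell_def mem_Minkowski_sum_iff)
  have "(\<Sum>c\<in>UNIV. x $ c) = (\<Sum>l<n. \<Sum>c\<in>UNIV. b l $ c)"
    unfolding x sum_component by (rule sum.swap)
  also have "\<dots> = real n" using b by (simp add: coord_face_def)
  finally show "x \<in> dilated_simplex n"
    using b x by (auto simp: dilated_simplex_eq sum_component coord_face_def intro!: sum_nonneg)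
qed

section \<open>Dimension of cells and genericity\<close>

text \<open>The incidences \<open>(l, c)\<close> with \<open>c \<in> I l\<close> form a bipartite graph; circulations on it exist exactly
  if it has a cycle. So the condition says that the graph is a forest, in a form that is linear in
  the edge weights.\<close>

definition circulation_free :: "nat \<Rightarrow> (nat \<Rightarrow> 'd set) \<Rightarrow> bool" where
  "circulation_free n I \<longleftrightarrow>
    (\<forall>A :: nat \<Rightarrow> 'd \<Rightarrow> real. (\<forall>l<n. \<forall>c. c \<notin> I l \<longrightarrow> A l c = 0) \<and> (\<forall>l<n. (\<Sum>c\<in>UNIV. A l c) = 0) \<and>
       (\<forall>c. (\<Sum>l<n. A l c) = 0) \<longrightarrow> (\<forall>l<n. \<forall>c. A l c = 0))"

lemma sum_scaleR_vertex_nth: "(\<Sum>k\<in>UNIV. a k *\<^sub>R vertex k :: real^'d) $ c = a c"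
proof -
  have "(\<Sum>k\<in>UNIV. a k *\<^sub>R vertex k :: real^'d) $ c = (\<Sum>k\<in>UNIV. if k = c then a k else 0)"
    unfolding sum_component by (intro sum.cong) (auto simp: axis_def)
  then show ?thesis by simp
qed

text \<open>After translation the sum is spanned by the vectors \<open>e\<^sub>c - e\<^sub>r\<close> with \<open>c \<in> I l\<close> and \<open>r\<close> a fixed
  element of \<open>I l\<close>, for all \<open>l\<close>. A linear relation between them is the same as a circulation:
  the coefficient of the fixed element is determined by the row sum being 0, and the column
  sums are the coordinates of the linear combination.\<close>

lemma aff_dim_Minkowski_sum_coord_face:
  fixes I :: "nat \<Rightarrow> 'd::finite set"
  assumes ne: "\<And>l. l < n \<Longrightarrow> I l \<noteq> {}" and free: "circulation_free n I"
  shows "aff_dim (\<Sum>l<n. coord_face (I l)) = (\<Sum>l<n. int (card (I l)) - 1)"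
proof -
  define r where "r = (\<lambda>l. SOME c. c \<in> I l)"
  have r: "r l \<in> I l" if "l < n" for l
    using ne[OF that] unfolding r_def by (simp add: some_in_eq)
  define J where "J = Sigma {..<n} (\<lambda>l. I l - {r l})"
  define g :: "nat \<times> 'd \<Rightarrow> real^'d" where "g = (\<lambda>(l, c). vertex c - vertex (r l))"
  define v0 :: "real^'d" where "v0 = (\<Sum>l<n. vertex (r l))"
  let ?C = "\<Sum>l<n. coord_face (I l)"
  have finJ: "finite J" by (auto simp: J_def)
  have J_zero: "\<forall>p\<in>J. f p = 0" if f: "(\<Sum>p\<in>J. f p *\<^sub>R g p) = 0" for f
  proof -
    define A where "A = (\<lambda>l c. if c = r l then - (\<Sum>c\<in>I l - {r l}. f (l, c)) else if c \<in> I l then f (l, c) else 0)"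
    have row_split: "(\<Sum>c\<in>UNIV. A l c *\<^sub>R v c) = (\<Sum>c\<in>I l - {r l}. f (l, c) *\<^sub>R (v c - v (r l)))"
      if "l < n" for l and v :: "'d \<Rightarrow> 'b::real_vector"
    proof -
      have "(\<Sum>c\<in>UNIV. A l c *\<^sub>R v c) = A l (r l) *\<^sub>R v (r l) + (\<Sum>c\<in>UNIV - {r l}. A l c *\<^sub>R v c)"
        by (rule sum.remove) auto
      also have "(\<Sum>c\<in>UNIV - {r l}. A l c *\<^sub>R v c) = (\<Sum>c\<in>I l - {r l}. A l c *\<^sub>R v c)"
        by (intro sum.mono_neutral_right) (auto simp: A_def)
      also have "\<dots> = (\<Sum>c\<in>I l - {r l}. f (l, c) *\<^sub>R v c)"
        by (intro sum.cong) (auto simp: A_def)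
      finally show ?thesis
        by (simp add: A_def scaleR_diff_right sum_subtractf scaleR_sum_left)
    qed
    have "(\<Sum>l<n. \<Sum>c\<in>UNIV. A l c *\<^sub>R vertex c) = (\<Sum>l<n. \<Sum>c\<in>I l - {r l}. f (l, c) *\<^sub>R g (l, c))"
      by (rule sum.cong) (simp_all add: row_split g_def)
    also have "\<dots> = (\<Sum>p\<in>J. f p *\<^sub>R g p)"
      unfolding J_def by (subst sum.Sigma) (auto simp: case_prod_unfold)
    finally have total: "(\<Sum>l<n. \<Sum>c\<in>UNIV. A l c *\<^sub>R vertex c) = (0 :: real^'d)" using f by simp
    have "(\<Sum>l<n. A l c) = 0" for c
    proof -
      have "(\<Sum>l<n. \<Sum>k\<in>UNIV. A l k *\<^sub>R vertex k :: real^'d) $ c = (\<Sum>l<n. A l c)"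
        by (subst sum_component) (simp only: sum_scaleR_vertex_nth)
      then show ?thesis using total by simp
    qed
    moreover have "(\<Sum>c\<in>UNIV. A l c) = 0" if "l < n" for l
      using row_split[OF that, of "\<lambda>_. 1::real"] by simp
    moreover have "A l c = 0" if "l < n" "c \<notin> I l" for l c
      using that r by (auto simp: A_def)
    ultimately have zero: "\<forall>l<n. \<forall>c. A l c = 0"
      using free unfolding circulation_free_def by blast
    show ?thesis
    proof
      fix p assume "p \<in> J"
      then obtain l c where p: "p = (l, c)" "l < n" "c \<in> I l" "c \<noteq> r l" by (auto simp: J_def)
      then have "A l c = f p" by (simp add: A_def)
      then show "f p = 0" using zero p(2) by simp
    qed
  qed
  have inj: "inj_on g J"
  proof (rule inj_onI, rule ccontr)
    fix p q assume pq: "p \<in> J" "q \<in> J" "g p = g q" "p \<noteq> q"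
    let ?f = "\<lambda>s. of_bool (s = p) - of_bool (s = q) :: real"
    have "(\<Sum>s\<in>J. ?f s *\<^sub>R g s) = (\<Sum>s\<in>J. if s = p then g s else 0) - (\<Sum>s\<in>J. if s = q then g s else 0)"
      unfolding sum_subtractf[symmetric] by (intro sum.cong) auto
    also have "\<dots> = 0" using pq finJ by simp
    finally have "?f p = 0" using J_zero[of ?f] pq by blast
    then show False using pq by simp
  qed
  have indep: "independent (g ` J)"
  proof (rule independent_if_scalars_zero)
    show "finite (g ` J)" using finJ by simp
    fix f x assume "(\<Sum>x\<in>g ` J. f x *\<^sub>R x) = 0" "x \<in> g ` J"
    then show "f x = 0" using J_zero[of "f \<circ> g"] inj by (auto simp: sum.reindex)
  qed
  have v0: "v0 \<in> ?C"
    unfolding mem_Minkowski_sum_iff v0_def using r by (intro exI[of _ "\<lambda>l. vertex (r l)"]) (auto intro: vertex_in_coord_face)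
  have sub: "g ` J \<subseteq> (+) (- v0) ` ?C"
  proof
    fix u assume "u \<in> g ` J"
    then obtain l c where lc: "l < n" "c \<in> I l" and u: "u = vertex c - vertex (r l)"
      by (auto simp: J_def g_def)
    let ?b = "\<lambda>m. if m = l then vertex c else vertex (r m) :: real^'d"
    have "(\<Sum>m<n. ?b m) \<in> ?C"
      unfolding mem_Minkowski_sum_iff using r lc by (intro exI[of _ ?b]) (auto intro: vertex_in_coord_face)
    moreover have "(\<Sum>m<n. ?b m) - v0 = (\<Sum>m<n. if m = l then u else 0)"
      unfolding v0_def sum_subtractf[symmetric] by (intro sum.cong) (auto simp: u)
    ultimately show "u \<in> (+) (- v0) ` ?C"
      using lc by (intro image_eqI[where x="\<Sum>m<n. ?b m"]) auto
  qed
  have span: "(+) (- v0) ` ?C \<subseteq> span (g ` J)"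
  proof
    fix u assume "u \<in> (+) (- v0) ` ?C"
    then obtain b where b: "\<forall>l<n. b l \<in> coord_face (I l)" and u: "u = (\<Sum>l<n. b l) - v0"
      by (auto simp: mem_Minkowski_sum_iff)
    have "b l - vertex (r l) \<in> span (g ` J)" if l: "l < n" for l
    proof -
      have bl: "b l \<in> coord_face (I l)" using b l by blast
      have "(\<Sum>c\<in>I l. b l $ c *\<^sub>R (vertex c - vertex (r l)))
          = (\<Sum>c\<in>I l. b l $ c *\<^sub>R vertex c) - (\<Sum>c\<in>I l. b l $ c) *\<^sub>R vertex (r l)"
        by (simp only: scaleR_diff_right sum_subtractf scaleR_sum_left)
      then have "b l - vertex (r l) = (\<Sum>c\<in>I l. b l $ c *\<^sub>R (vertex c - vertex (r l)))"
        using coord_face_barycentric[OF bl] by simp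
      also have "\<dots> \<in> span (g ` J)"
      proof (intro span_sum span_scale)
        fix c assume c: "c \<in> I l"
        show "vertex c - vertex (r l) \<in> span (g ` J)"
        proof (cases "c = r l")
          case False
          then have "g (l, c) \<in> g ` J" using l c by (auto simp: J_def)
          then show ?thesis by (simp add: g_def span_base)
        qed (simp add: span_zero)
      qed
      finally show ?thesis .
    qed
    moreover have "u = (\<Sum>l<n. b l - vertex (r l))" by (simp add: u v0_def sum_subtractf)
    ultimately show "u \<in> span (g ` J)" by (auto intro: span_sum)
  qed
  have "card (g ` J) = (\<Sum>l<n. card (I l) - 1)"
  proof -
    have "card (g ` J) = card J" using inj by (rule card_image)
    also have "\<dots> = (\<Sum>l<n. card (I l - {r l}))" unfolding J_def by (rule card_SigmaI) auto
    also have "\<dots> = (\<Sum>l<n. card (I l) - 1)" using r by (intro sum.cong) auto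
    finally show ?thesis .
  qed
  moreover have "dim ((+) (- v0) ` ?C) = card (g ` J)"
    using sub span indep by (intro dim_unique) auto
  moreover have "aff_dim ?C = int (dim ((+) (- v0) ` ?C))"
    using v0 by (intro aff_dim_eq_dim) (simp add: hull_inc)
  moreover have "int (card (I l) - 1) = int (card (I l)) - 1" if "l < n" for l
    using ne[OF that] by (simp add: of_nat_diff Suc_leI card_gt_0_iff)
  ultimately show ?thesis by simp
qed

lemma aff_dim_coord_face:
  fixes I :: "'d::finite set"
  assumes "I \<noteq> {}"
  shows "aff_dim (coord_face I) = int (card I) - 1"
  using aff_dim_Minkowski_sum_coord_face[of 1 "\<lambda>_. I"] assms by (simp add: circulation_free_def)

lemma fine_mixed_cell_regular_cell:
  fixes W :: "nat \<Rightarrow> real^'d"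
  assumes free: "circulation_free n (\<lambda>l. tight (W l) y)" and full: "aff_dim (regular_cell n W y) = int CARD('d) - 1"
  shows "fine_mixed_cell n (regular_cell n W y)"
proof -
  let ?B = "\<lambda>l. coord_face (tight (W l) y)"
  have "aff_dim (\<Sum>l<n. ?B l) = (\<Sum>l<n. aff_dim (?B l))"
    using aff_dim_Minkowski_sum_coord_face[OF tight_nonempty free] by (simp add: aff_dim_coord_face tight_nonempty)
  moreover have "?B l \<noteq> {}" for l
    using tight_nonempty vertex_in_coord_face by (metis all_not_in_conv)
  ultimately show ?thesis
    unfolding fine_mixed_cell_def regular_cell_def using full[unfolded regular_cell_def]
    by (intro exI[of _ ?B]) (simp add: coord_face_face_of)
qed

text \<open>Induction on the number of hyperplanes: a point on the new hyperplane is pushed off along the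
  normal vector, by an amount too small to reach the previous ones.\<close>

lemma avoid_hyperplanes:
  fixes w0 :: "'k \<Rightarrow> real"
  assumes K: "finite K" and fin: "finite \<A>" and ne: "\<And>A. A \<in> \<A> \<Longrightarrow> \<exists>k\<in>K. A k \<noteq> 0" and \<delta>: "0 < \<delta>"
  shows "\<exists>w. (\<forall>k. \<bar>w k - w0 k\<bar> < \<delta>) \<and> (\<forall>A\<in>\<A>. (\<Sum>k\<in>K. A k * w k) \<noteq> 0)"
  using fin ne
proof (induction \<A> rule: finite_induct)
  case empty
  then show ?case using \<delta> by (intro exI[of _ w0]) simp
next
  case (insert A \<A>)
  then obtain w where w: "\<And>k. \<bar>w k - w0 k\<bar> < \<delta>" "\<And>A. A \<in> \<A> \<Longrightarrow> (\<Sum>k\<in>K. A k * w k) \<noteq> 0"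
    by auto
  show ?case
  proof (cases "(\<Sum>k\<in>K. A k * w k) = 0")
    case False
    then show ?thesis using w by blast
  next
    case True
    have near: "\<forall>\<^sub>F s in at_right 0. \<forall>k\<in>K. \<bar>w k + s * A k - w0 k\<bar> < \<delta>"
    proof (rule eventually_ball_finite[OF K], rule ballI)
      fix k
      have "((\<lambda>s. \<bar>w k + s * A k - w0 k\<bar>) \<longlongrightarrow> \<bar>w k + 0 * A k - w0 k\<bar>) (at_right 0)"
        by (intro tendsto_intros)
      then show "\<forall>\<^sub>F s in at_right 0. \<bar>w k + s * A k - w0 k\<bar> < \<delta>"
        using w(1)[of k] by (intro order_tendstoD(2)) auto
    qed
    have avoid: "\<forall>\<^sub>F s in at_right 0. \<forall>A'\<in>\<A>. (\<Sum>k\<in>K. A' k * (w k + s * A k)) \<noteq> 0"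
    proof (rule eventually_ball_finite[OF insert.hyps(1)], rule ballI)
      fix A' assume A': "A' \<in> \<A>"
      have "((\<lambda>s. \<Sum>k\<in>K. A' k * (w k + s * A k)) \<longlongrightarrow> (\<Sum>k\<in>K. A' k * (w k + 0 * A k))) (at_right 0)"
        by (intro tendsto_intros)
      then show "\<forall>\<^sub>F s in at_right 0. (\<Sum>k\<in>K. A' k * (w k + s * A k)) \<noteq> 0"
        using w(2)[OF A'] by (intro tendsto_imp_eventually_ne) auto
    qed
    obtain s where s: "0 < s" "\<forall>k\<in>K. \<bar>w k + s * A k - w0 k\<bar> < \<delta>"
        "\<forall>A'\<in>\<A>. (\<Sum>k\<in>K. A' k * (w k + s * A k)) \<noteq> 0"
      using eventually_happens[OF eventually_conj[OF eventually_at_right_less[of 0] eventually_conj[OF near avoid]]]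
      by (auto simp: trivial_limit_at_right_real)
    define w' where "w' = (\<lambda>k. if k \<in> K then w k + s * A k else w k)"
    have sum_w': "(\<Sum>k\<in>K. A' k * w' k) = (\<Sum>k\<in>K. A' k * (w k + s * A k))" for A'
      by (intro sum.cong) (auto simp: w'_def)
    have "(\<Sum>k\<in>K. A k * w' k) = (\<Sum>k\<in>K. A k * w k) + s * (\<Sum>k\<in>K. A k * A k)"
      unfolding sum_w' by (simp add: algebra_simps sum.distrib sum_distrib_left)
    also have "\<dots> = s * (\<Sum>k\<in>K. A k * A k)" using True by simp
    also have "\<dots> \<noteq> 0"
      using s(1) insert.prems[of A] K by (auto simp: sum_nonneg_eq_0_iff)
    finally have "\<forall>A'\<in>insert A \<A>. (\<Sum>k\<in>K. A' k * w' k) \<noteq> 0"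
      using s(3) sum_w' by auto
    moreover have "\<forall>k. \<bar>w' k - w0 k\<bar> < \<delta>" using s(2) w(1) by (auto simp: w'_def)
    ultimately show ?thesis by blast
  qed
qed

definition generic :: "nat \<Rightarrow> (nat \<Rightarrow> real^'d) \<Rightarrow> bool" where
  "generic n W \<longleftrightarrow> (\<forall>y. circulation_free n (\<lambda>l. tight (W l) y))"

text \<open>On tight incidences the weight splits as \<open>W l c = y c + slack_min (W l) y\<close>, and a circulation is
  orthogonal to every matrix of this form.\<close>

lemma sum_circulation_weights:
  fixes W :: "nat \<Rightarrow> real^'d"
  assumes supp: "\<And>l c. l < n \<Longrightarrow> c \<notin> tight (W l) y \<Longrightarrow> A l c = 0"
    and row: "\<And>l. l < n \<Longrightarrow> (\<Sum>c\<in>UNIV. A l c) = 0" and col: "\<And>c. (\<Sum>l<n. A l c) = 0"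
  shows "(\<Sum>l<n. \<Sum>c\<in>UNIV. A l c * W l $ c) = 0"
proof -
  have "(\<Sum>l<n. \<Sum>c\<in>UNIV. A l c * W l $ c) = (\<Sum>l<n. \<Sum>c\<in>UNIV. A l c * y $ c + A l c * slack_min (W l) y)"
  proof (intro sum.cong refl)
    fix l c assume "l \<in> {..<n}"
    then show "A l c * W l $ c = A l c * y $ c + A l c * slack_min (W l) y"
      using supp[of l c] by (cases "c \<in> tight (W l) y") (auto simp: tight_def simp flip: distrib_left)
  qed
  also have "\<dots> = (\<Sum>c\<in>UNIV. \<Sum>l<n. A l c * y $ c) + (\<Sum>l<n. \<Sum>c\<in>UNIV. A l c * slack_min (W l) y)"
    by (simp add: sum.distrib sum.swap[of _ "{..<n}" UNIV])
  also have "\<dots> = 0" using row col by (simp flip: sum_distrib_right)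
  finally show ?thesis .
qed

text \<open>There are only finitely many families \<open>I\<close> that carry a circulation. It suffices to choose one
  circulation for each of them and to avoid the hyperplane orthogonal to it: by
  \<open>sum_circulation_weights\<close> such a family is then never tight.\<close>

lemma generic_perturbation:
  fixes W0 :: "nat \<Rightarrow> real^'d"
  assumes \<delta>: "0 < \<delta>"
  obtains W where "generic n W" and "\<And>l c. \<bar>W l $ c - W0 l $ c\<bar> < \<delta>"
proof -
  define bad where "bad = {I \<in> PiE {..<n} (\<lambda>_. UNIV :: 'd set set). \<not> circulation_free n I}"
  have "finite (PiE {..<n} (\<lambda>_. UNIV :: 'd set set))" by (intro finite_PiE) auto
  then have fin: "finite bad" by (simp add: bad_def)
  have "\<forall>I\<in>bad. \<exists>A. (\<forall>l<n. \<forall>c. c \<notin> I l \<longrightarrow> A l c = (0::real)) \<and> (\<forall>l<n. (\<Sum>c\<in>UNIV. A l c) = 0) \<and>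
       (\<forall>c. (\<Sum>l<n. A l c) = 0) \<and> (\<exists>l<n. \<exists>c. A l c \<noteq> 0)"
    unfolding bad_def circulation_free_def by blast
  then obtain A where A: "\<And>I l c. I \<in> bad \<Longrightarrow> l < n \<Longrightarrow> c \<notin> I l \<Longrightarrow> A I l c = (0::real)"
      "\<And>I l. I \<in> bad \<Longrightarrow> l < n \<Longrightarrow> (\<Sum>c\<in>UNIV. A I l c) = 0"
      "\<And>I c. I \<in> bad \<Longrightarrow> (\<Sum>l<n. A I l c) = 0" "\<And>I. I \<in> bad \<Longrightarrow> \<exists>l<n. \<exists>c. A I l c \<noteq> 0"
    unfolding bchoice_iff by blast
  let ?K = "{..<n} \<times> (UNIV :: 'd set)"
  let ?A = "(\<lambda>I (l, c). A I l c) ` bad"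
  have "\<exists>w. (\<forall>k. \<bar>w k - (\<lambda>(l, c). W0 l $ c) k\<bar> < \<delta>) \<and> (\<forall>A\<in>?A. (\<Sum>k\<in>?K. A k * w k) \<noteq> 0)"
    using fin A(4) by (intro avoid_hyperplanes \<delta>) fastforce+
  then obtain w where w: "\<And>k. \<bar>w k - (\<lambda>(l, c). W0 l $ c) k\<bar> < \<delta>"
      "\<And>I. I \<in> bad \<Longrightarrow> (\<Sum>k\<in>?K. (\<lambda>(l, c). A I l c) k * w k) \<noteq> 0"
    by blast
  define W :: "nat \<Rightarrow> real^'d" where "W = (\<lambda>l. \<chi> c. w (l, c))"
  have "circulation_free n (\<lambda>l. tight (W l) y)" for y
  proof (rule ccontr)
    assume not_free: "\<not> circulation_free n (\<lambda>l. tight (W l) y)"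
    \<comment> \<open>Only the restriction to \<open>{..<n}\<close> belongs to the finite set of families considered.\<close>
    let ?I = "\<lambda>l\<in>{..<n}. tight (W l) y"
    have "circulation_free n ?I \<longleftrightarrow> circulation_free n (\<lambda>l. tight (W l) y)"
      by (simp add: circulation_free_def)
    then have bad: "?I \<in> bad" using not_free by (simp add: bad_def)
    have "(\<Sum>l<n. \<Sum>c\<in>UNIV. A ?I l c * W l $ c) = 0"
      using A(1-3)[OF bad] by (intro sum_circulation_weights[where y=y]) auto
    then have "(\<Sum>k\<in>?K. (\<lambda>(l, c). A ?I l c) k * w k) = 0"
      by (simp add: W_def sum.cartesian_product case_prod_unfold)
    then show False using w(2)[OF bad] by simp
  qed
  then have "generic n W" by (simp add: generic_def)
  moreover have "\<bar>W l $ c - W0 l $ c\<bar> < \<delta>" for l c using w(1)[of "(l, c)"] by (simp add: W_def)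
  ultimately show ?thesis using that by blast
qed

section \<open>Regular cells cover the dilated simplex\<close>

lemma continuous_on_Min_image:
  fixes f :: "'c \<Rightarrow> 'a::topological_space \<Rightarrow> real"
  assumes "finite A" "A \<noteq> {}" "\<And>c. c \<in> A \<Longrightarrow> continuous_on S (f c)"
  shows "continuous_on S (\<lambda>y. Min ((\<lambda>c. f c y) ` A))"
  using assms
proof (induction A rule: finite_ne_induct)
  case (insert c A)
  then have "Min ((\<lambda>c. f c y) ` insert c A) = min (f c y) (Min ((\<lambda>c. f c y) ` A))" for y by simp
  then show ?case using insert by (auto intro!: continuous_on_min)
qed simp

lemma continuous_on_dual_value: "continuous_on (S :: (real^'d) set) (dual_value n W x)"
proof -
  have "continuous_on S (slack_min w)" for w :: "real^'d"
    unfolding slack_min_def by (intro continuous_on_Min_image continuous_intros) auto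
  then show ?thesis unfolding dual_value_def by (intro continuous_intros) auto
qed

lemma slack_min_eqI:
  assumes "\<And>c. m \<le> w $ c - y $ c" "m = w $ k - y $ k"
  shows "slack_min w y = m"
  unfolding slack_min_def using assms by (intro Min_eqI) auto

lemma slack_min_attained: obtains c where "slack_min w y = w $ c - y $ c"
proof -
  obtain c where "c \<in> tight w y" using tight_nonempty by blast
  then show ?thesis using that[of c] by (simp add: tight_def)
qed

lemma dual_value_shift:
  assumes "(\<Sum>c\<in>UNIV. x $ c) = real n"
  shows "dual_value n W x (y + (\<chi> c. s)) = dual_value n W x y"
proof -
  have "slack_min w (y + (\<chi> c. s)) = slack_min w y - s" for w
  proof -
    obtain k where "slack_min w y = w $ k - y $ k" by (rule slack_min_attained)
    then show ?thesis using slack_min_le[of w y] by (intro slack_min_eqI[of _ _ _ k]) (auto simp: algebra_simps)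
  qed
  moreover have "(\<chi> c. s) \<bullet> x = real n * s"
    using assms by (simp add: inner_vec_def mult.commute flip: sum_distrib_left)
  ultimately show ?thesis by (simp add: dual_value_def inner_add_left sum_subtractf)
qed

text \<open>The dual objective is invariant under adding a constant to \<open>y\<close>, so the largest entry of \<open>y\<close> can
  be taken to be 0. As all coordinates of \<open>x\<close> are positive, the objective then drops below its value
  at 0 as soon as some entry of \<open>y\<close> is very negative, and a maximum over a box is a global one.\<close>

lemma dual_value_attains_max:
  fixes x :: "real^'d"
  assumes pos: "\<And>c. 0 < x $ c" and sum: "(\<Sum>c\<in>UNIV. x $ c) = real n"
  obtains y where "\<And>y'. dual_value n W x y' \<le> dual_value n W x y"
proof -
  let ?G = "dual_value n W x"
  define \<delta> where "\<delta> = Min (range (\<lambda>c. x $ c))"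
  have \<delta>: "0 < \<delta>" "\<And>c. \<delta> \<le> x $ c" using pos by (auto simp: \<delta>_def)
  define M where "M = (\<Sum>l<n. Max (range (\<lambda>c. W l $ c)))"
  \<comment> \<open>The bound of the dual objective in \<open>far\<close> below equals its value at 0 for this \<open>R\<close>.\<close>
  define R where "R = max 0 ((M - ?G 0) / \<delta>)"
  have far: "?G y \<le> ?G 0" if y: "\<And>c. y $ c \<le> 0" "y $ k = 0" "y $ c < - R" for y k c
  proof -
    have "slack_min (W l) y \<le> Max (range (\<lambda>c. W l $ c))" for l
    proof -
      have "slack_min (W l) y \<le> W l $ k" using slack_min_le[of "W l" y k] y(2) by simp
      also have "\<dots> \<le> Max (range (\<lambda>c. W l $ c))" by (rule Max_ge) auto
      finally show ?thesis .
    qed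
    then have 1: "(\<Sum>l<n. slack_min (W l) y) \<le> M" unfolding M_def by (intro sum_mono)
    have "y \<bullet> x = y $ c * x $ c + (\<Sum>k\<in>UNIV - {c}. y $ k * x $ k)"
      by (simp add: inner_vec_def sum.remove[of UNIV c])
    also have "\<dots> \<le> y $ c * x $ c"
    proof -
      have "(\<Sum>k\<in>UNIV - {c}. y $ k * x $ k) \<le> 0"
        using y(1) pos by (intro sum_nonpos mult_nonpos_nonneg) (simp_all add: less_imp_le)
      then show ?thesis by simp
    qed
    also have "\<dots> \<le> y $ c * \<delta>" using \<delta>(2) y(1) by (intro mult_left_mono_neg)
    also have "\<dots> \<le> (- R) * \<delta>" using y(3) \<delta>(1) by (intro mult_right_mono) auto
    also have "\<dots> \<le> - ((M - ?G 0) / \<delta>) * \<delta>" using \<delta>(1) by (intro mult_right_mono) (auto simp: R_def)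
    also have "\<dots> = ?G 0 - M" using \<delta>(1) by simp
    finally show ?thesis using 1 by (simp add: dual_value_def)
  qed
  let ?B = "cbox (\<chi> c. - R) 0 :: (real^'d) set"
  have B: "y \<in> ?B \<longleftrightarrow> (\<forall>c. - R \<le> y $ c \<and> y $ c \<le> 0)" for y by (simp add: mem_box_cart)
  have zero: "0 \<in> ?B" using B by (simp add: R_def)
  obtain y0 where y0: "y0 \<in> ?B" "\<And>y. y \<in> ?B \<Longrightarrow> ?G y \<le> ?G y0"
    using continuous_attains_sup[OF compact_cbox _ continuous_on_dual_value, of "\<chi> c. - R" 0 n W x] zero by blast
  have "?G y \<le> ?G y0" for y
  proof -
    define m where "m = Max (range (\<lambda>c. y $ c))"
    define z where "z = y + (\<chi> c. - m)"
    have "y $ c \<le> m" for c unfolding m_def by (intro Max_ge) auto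
    then have z_le: "z $ c \<le> 0" for c by (simp add: z_def)
    have "m \<in> range (\<lambda>c. y $ c)" unfolding m_def by (intro Max_in) auto
    then obtain k where "z $ k = 0" by (auto simp: z_def)
    then have "?G z \<le> ?G y0"
      using y0(2)[of z] far[of z k] y0(2)[OF zero] z_le B[of z] by (meson not_le order_trans)
    then show ?thesis using dual_value_shift[OF sum] by (simp add: z_def)
  qed
  then show ?thesis using that by blast
qed

text \<open>Strong duality. Let \<open>y\<close> maximise the dual objective. If \<open>x\<close> were not in the cell of \<open>y\<close>, a hyperplane
  with normal vector \<open>a\<close> would separate them, and moving \<open>y\<close> a little in the direction \<open>-a\<close> would
  increase the objective: each minimum \<open>slack_min (W l)\<close> grows at the rate of the smallest entry of
  \<open>a\<close> on the tight set of \<open>l\<close>, and the vertex of the cell where these entries are attained is on the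
  other side of the hyperplane.\<close>

lemma regular_cells_cover_positive:
  fixes x :: "real^'d"
  assumes pos: "\<And>c. 0 < x $ c" and sum: "(\<Sum>c\<in>UNIV. x $ c) = real n"
  shows "\<exists>y. x \<in> regular_cell n W y"
proof -
  obtain y where y: "\<And>y'. dual_value n W x y' \<le> dual_value n W x y"
    using dual_value_attains_max[OF assms] by blast
  have "x \<in> regular_cell n W y"
  proof (rule ccontr)
    assume x: "x \<notin> regular_cell n W y"
    have "convex (regular_cell n W y)" "closed (regular_cell n W y)"
      unfolding regular_cell_def by (simp_all add: convex_compact_Minkowski_sum compact_imp_closed)
    then obtain a \<beta> where sep: "a \<bullet> x < \<beta>" "\<And>p. p \<in> regular_cell n W y \<Longrightarrow> \<beta> < a \<bullet> p"
      using separating_hyperplane_closed_point[of "regular_cell n W y" x] x by blast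
    have "\<exists>c\<in>tight (W l) y. \<forall>c'\<in>tight (W l) y. a $ c \<le> a $ c'" for l
      using ex_min_if_finite[of "(\<lambda>c. a $ c) ` tight (W l) y"] tight_nonempty by (force simp: not_less)
    then obtain k where k: "\<And>l. k l \<in> tight (W l) y" "\<And>l c. c \<in> tight (W l) y \<Longrightarrow> a $ k l \<le> a $ c"
      by metis
    have ev: "\<forall>\<^sub>F e in at_right 0. \<forall>l\<in>{..<n}. \<forall>c\<in>UNIV. slack_min (W l) y + e * a $ k l \<le> W l $ c - (y - e *\<^sub>R a) $ c"
    proof (intro eventually_ball_finite ballI finite_lessThan finite)
      fix l c
      show "\<forall>\<^sub>F e in at_right 0. slack_min (W l) y + e * a $ k l \<le> W l $ c - (y - e *\<^sub>R a) $ c"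
      proof (cases "c \<in> tight (W l) y")
        case True
        have "\<forall>\<^sub>F e in at_right (0::real). 0 < e" by (rule eventually_at_right_less)
        then show ?thesis
        proof eventually_elim
          case (elim e)
          then have "e * a $ k l \<le> e * a $ c" using k(2)[OF True] by simp
          then show ?case using True by (simp add: tight_def)
        qed
      next
        case False
        have "((\<lambda>e. W l $ c - (y - e *\<^sub>R a) $ c - (slack_min (W l) y + e * a $ k l)) \<longlongrightarrow>
            W l $ c - (y - 0 *\<^sub>R a) $ c - (slack_min (W l) y + 0 * a $ k l)) (at_right 0)"
          by (intro tendsto_intros)
        then have "\<forall>\<^sub>F e in at_right 0. 0 < W l $ c - (y - e *\<^sub>R a) $ c - (slack_min (W l) y + e * a $ k l)"
          using slack_min_less[OF False] by (intro order_tendstoD(1)) auto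
        then show ?thesis by eventually_elim simp
      qed
    qed
    obtain e where e: "0 < e"
        "\<And>l c. l < n \<Longrightarrow> slack_min (W l) y + e * a $ k l \<le> W l $ c - (y - e *\<^sub>R a) $ c"
      using eventually_happens'[OF trivial_limit_at_right_real eventually_conj[OF eventually_at_right_less ev]]
      by blast
    define p where "p = (\<Sum>l<n. vertex (k l))"
    have "p \<in> regular_cell n W y"
      unfolding regular_cell_def mem_Minkowski_sum_iff p_def using k(1)
      by (intro exI[of _ "\<lambda>l. vertex (k l)"]) (simp add: vertex_in_coord_face)
    then have "a \<bullet> x < a \<bullet> p" using sep by fastforce
    have "(\<Sum>l<n. slack_min (W l) y + e * a $ k l) \<le> (\<Sum>l<n. slack_min (W l) (y - e *\<^sub>R a))"
    proof (intro sum_mono)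
      fix l assume "l \<in> {..<n}"
      moreover obtain c where "slack_min (W l) (y - e *\<^sub>R a) = W l $ c - (y - e *\<^sub>R a) $ c"
        by (rule slack_min_attained)
      ultimately show "slack_min (W l) y + e * a $ k l \<le> slack_min (W l) (y - e *\<^sub>R a)" using e(2) by simp
    qed
    moreover have "(\<Sum>l<n. e * a $ k l) = e * (a \<bullet> p)"
      by (simp add: p_def inner_sum_right inner_axis sum_distrib_left)
    ultimately have "dual_value n W x y + e * (a \<bullet> p - a \<bullet> x) \<le> dual_value n W x (y - e *\<^sub>R a)"
      by (simp add: dual_value_def inner_diff_left sum.distrib algebra_simps)
    moreover have "0 < e * (a \<bullet> p - a \<bullet> x)" using e(1) \<open>a \<bullet> x < a \<bullet> p\<close> by simp
    ultimately show False using y[of "y - e *\<^sub>R a"] by linarith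
  qed
  then show ?thesis by blast
qed

definition full_cells :: "nat \<Rightarrow> (nat \<Rightarrow> real^'d) \<Rightarrow> (real^'d) set set" where
  "full_cells n W = {C \<in> range (regular_cell n W). aff_dim C = int CARD('d) - 1}"

lemma dim_le_aff_dim_plus_1:
  fixes S :: "'a::euclidean_space set"
  shows "int (dim S) \<le> aff_dim S + 1"
proof -
  have "int (dim (insert 0 S)) = aff_dim (insert 0 S)" by (simp add: aff_dim_zero hull_inc)
  also have "\<dots> \<le> aff_dim S + 1" by (simp add: aff_dim_insert)
  finally show ?thesis by (simp add: dim_insert span_zero)
qed

lemma aff_dim_dilated_simplex_le: "aff_dim (dilated_simplex n :: (real^'d) set) \<le> int CARD('d) - 1"
proof -
  let ?one = "(\<chi> c. 1) :: real^'d"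
  have "dilated_simplex n \<subseteq> {x. ?one \<bullet> x = real n}"
    by (auto simp: dilated_simplex_eq inner_vec_def)
  then have "aff_dim (dilated_simplex n :: (real^'d) set) \<le> aff_dim {x. ?one \<bullet> x = real n}" by (rule aff_dim_subset)
  also have "?one \<noteq> 0" by (simp add: vec_eq_iff)
  then have "aff_dim {x. ?one \<bullet> x = real n} = int CARD('d) - 1" by simp
  finally show ?thesis .
qed

lemma negligible_span_of_lower_cell:
  fixes W :: "nat \<Rightarrow> real^'d"
  assumes "regular_cell n W y \<notin> full_cells n W"
  shows "negligible (span (regular_cell n W y))"
proof -
  have "aff_dim (regular_cell n W y) \<le> int CARD('d) - 1"
    using aff_dim_subset[OF regular_cell_subset] aff_dim_dilated_simplex_le by (rule order_trans)
  moreover have "aff_dim (regular_cell n W y) \<noteq> int CARD('d) - 1"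
    using assms by (simp add: full_cells_def)
  ultimately have "dim (regular_cell n W y) < CARD('d)"
    using dim_le_aff_dim_plus_1[of "regular_cell n W y"] by linarith
  then show ?thesis by (intro negligible_lowdim) (simp add: dim_span)
qed

lemma finite_full_cells: "finite (full_cells n W)"
  using finite_subset[OF _ finite_regular_cells[of n W]] by (auto simp: full_cells_def)

lemma closed_Union_full_cells: "closed (\<Union>(full_cells n W))"
proof (intro closed_Union finite_full_cells ballI)
  fix C assume "C \<in> full_cells n W"
  then obtain y where "C = regular_cell n W y" by (auto simp: full_cells_def)
  then show "closed C"
    by (simp add: regular_cell_def compact_imp_closed convex_compact_Minkowski_sum)
qed

text \<open>If the point \<open>p\<close> lies in no cell of full dimension, then by closedness neither does any nearby point.
  The rays through these points fill an open set, but they lie in the spans of the finitely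
  many cells of smaller dimension, which are null sets.\<close>

lemma full_cells_cover_positive:
  fixes p :: "real^'d"
  assumes n: "0 < n" and pos: "\<And>c. 0 < p $ c" and sum: "(\<Sum>c\<in>UNIV. p $ c) = real n"
  shows "p \<in> \<Union>(full_cells n W)"
proof (rule ccontr)
  assume p: "p \<notin> \<Union>(full_cells n W)"
  note closed = closed_Union_full_cells[of n W]
  define s :: "real^'d \<Rightarrow> real" where "s x = (\<Sum>c\<in>UNIV. x $ c)" for x
  define Q :: "(real^'d) set" where "Q = {x. \<forall>c. 0 < x $ c}"
  define O' where "O' = {x \<in> Q. (real n / s x) *\<^sub>R x \<in> - \<Union>(full_cells n W)}"
  have s_pos: "0 < s x" if "x \<in> Q" for x
    using that unfolding s_def Q_def by (intro sum_pos) auto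
  have "Q = (\<Inter>c\<in>UNIV. {x. 0 < x $ c})" by (auto simp: Q_def)
  also have "open \<dots>" by (intro open_INT ballI open_Collect_less continuous_intros) auto
  finally have "open Q" .
  moreover have "\<forall>x\<in>Q. s x \<noteq> 0" using s_pos by fastforce
  then have "continuous_on Q (\<lambda>x. (real n / s x) *\<^sub>R x)"
    unfolding s_def by (intro continuous_intros) auto
  ultimately have "open (Q \<inter> (\<lambda>x. (real n / s x) *\<^sub>R x) -` (- \<Union>(full_cells n W)))"
    using open_Compl[OF closed_Union_full_cells[of n W]] by (intro continuous_open_preimage)
  moreover have "O' = Q \<inter> (\<lambda>x. (real n / s x) *\<^sub>R x) -` (- \<Union>(full_cells n W))"
    by (auto simp: O'_def)
  ultimately have "open O'" by simp
  moreover have "p \<in> O'"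
  proof -
    have "(real n / s p) *\<^sub>R p = p" using sum n by (simp add: s_def)
    then show ?thesis using p pos unfolding O'_def Q_def by simp
  qed
  ultimately have "\<not> negligible O'" using open_not_negligible by blast
  \<comment> \<open>The cells of smaller dimension.\<close>
  let ?L = "{C \<in> range (regular_cell n W). C \<notin> full_cells n W}"
  have "O' \<subseteq> (\<Union>C\<in>?L. span C)"
  proof
    fix x assume x: "x \<in> O'"
    let ?x = "(real n / s x) *\<^sub>R x"
    have xQ: "x \<in> Q" "0 < s x" using x s_pos by (auto simp: O'_def)
    have "(\<Sum>c\<in>UNIV. ?x $ c) = real n"
    proof -
      have "(\<Sum>c\<in>UNIV. ?x $ c) = real n / s x * (\<Sum>c\<in>UNIV. x $ c)"
        by (simp add: sum_distrib_left)
      then show ?thesis using xQ(2) by (simp flip: s_def)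
    qed
    moreover have "0 < ?x $ c" for c using xQ n by (simp add: Q_def)
    ultimately obtain y where y: "?x \<in> regular_cell n W y"
      using regular_cells_cover_positive[of ?x n W] by blast
    have "(s x / real n) *\<^sub>R ?x \<in> span (regular_cell n W y)"
      using y by (intro span_scale span_base)
    then have "x \<in> span (regular_cell n W y)" using xQ(2) n by simp
    moreover have "regular_cell n W y \<notin> full_cells n W" using x y by (auto simp: O'_def)
    ultimately show "x \<in> (\<Union>C\<in>?L. span C)" by blast
  qed
  moreover have "negligible (\<Union>C\<in>?L. span C)"
    using finite_regular_cells[of n W] negligible_span_of_lower_cell by (intro negligible_Union) auto
  ultimately show False using \<open>\<not> negligible O'\<close> negligible_subset by blast
qed

lemma Union_full_cells:
  fixes W :: "nat \<Rightarrow> real^'d"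
  assumes n: "0 < n"
  shows "\<Union>(full_cells n W) = dilated_simplex n"
proof
  show "\<Union>(full_cells n W) \<subseteq> dilated_simplex n"
    using regular_cell_subset by (fastforce simp: full_cells_def)
  show "dilated_simplex n \<subseteq> \<Union>(full_cells n W)"
  proof
    fix p :: "real^'d" assume p: "p \<in> dilated_simplex n"
    \<comment> \<open>The barycentre; the open segment from \<open>p\<close> to it has positive coordinates only.\<close>
    define m :: "real^'d" where "m = (\<chi> c. real n / CARD('d))"
    note closed = closed_Union_full_cells[of n W]
    have "((\<lambda>e. (1 - e) *\<^sub>R p + e *\<^sub>R m) \<longlongrightarrow> (1 - 0) *\<^sub>R p + 0 *\<^sub>R m) (at_right 0)"
      by (intro tendsto_intros)
    moreover have "\<forall>\<^sub>F e in at_right (0::real). (1 - e) *\<^sub>R p + e *\<^sub>R m \<in> \<Union>(full_cells n W)"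
    proof -
      have "\<forall>\<^sub>F e in at_right (0::real). e \<in> {0<..<1}" by (rule eventually_at_right_real) simp
      then show ?thesis
      proof eventually_elim
        case (elim e)
        have "(\<Sum>c\<in>UNIV. m $ c) = real n" by (simp add: m_def)
        moreover have "(\<Sum>c\<in>UNIV. ((1 - e) *\<^sub>R p + e *\<^sub>R m) $ c)
            = (1 - e) * (\<Sum>c\<in>UNIV. p $ c) + e * (\<Sum>c\<in>UNIV. m $ c)"
          by (simp add: sum.distrib sum_distrib_left)
        ultimately have "(\<Sum>c\<in>UNIV. ((1 - e) *\<^sub>R p + e *\<^sub>R m) $ c) = real n"
          using p by (simp add: dilated_simplex_eq algebra_simps)
        moreover have "0 < ((1 - e) *\<^sub>R p + e *\<^sub>R m) $ c" for c
          using elim p n by (auto simp: dilated_simplex_eq m_def intro!: add_nonneg_pos)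
        ultimately show ?case using n by (intro full_cells_cover_positive)
      qed
    qed
    ultimately have "(1 - 0) *\<^sub>R p + 0 *\<^sub>R m \<in> \<Union>(full_cells n W)"
      by (intro Lim_in_closed_set[OF closed]) auto
    then show "p \<in> \<Union>(full_cells n W)" by simp
  qed
qed

lemma fine_mixed_subdivision_full_cells:
  fixes W :: "nat \<Rightarrow> real^'d"
  assumes "0 < n" and "generic n W"
  shows "fine_mixed_subdivision n (full_cells n W)"
  unfolding fine_mixed_subdivision_def
proof (intro conjI ballI)
  show "finite (full_cells n W)" by (rule finite_full_cells)
  show "\<Union>(full_cells n W) = dilated_simplex n" using assms(1) by (rule Union_full_cells)
  fix C assume "C \<in> full_cells n W"
  then obtain y where C: "C = regular_cell n W y" and full: "aff_dim C = int CARD('d) - 1"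
    by (auto simp: full_cells_def)
  show "fine_mixed_cell n C"
    using assms(2) full unfolding C generic_def by (intro fine_mixed_cell_regular_cell) auto
  fix D assume "D \<in> full_cells n W"
  then obtain y' where D: "D = regular_cell n W y'" by (auto simp: full_cells_def)
  show "(C \<inter> D) face_of C" unfolding C D by (rule regular_cell_Int_face_of)
  show "(C \<inter> D) face_of D" unfolding C D by (subst Int_commute) (rule regular_cell_Int_face_of)
qed

section \<open>Three edges without a common coordinate\<close>

lemma Minkowski_sum_unit_simplex:
  fixes I :: "nat \<Rightarrow> 'd::finite set"
  assumes l: "l < n" and UNIV: "I l = UNIV" and single: "\<And>m. m < n \<Longrightarrow> m \<noteq> l \<Longrightarrow> I m = {k m}"
  shows "(\<Sum>m<n. coord_face (I m)) = unit_simplex (\<lambda>c. card {m. m < n \<and> m \<noteq> l \<and> k m = c})"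
proof -
  let ?M = "{..<n} - {l}"
  have split: "(\<Sum>m<n. f m) = f l + (\<Sum>m\<in>?M. f m)" for f :: "nat \<Rightarrow> real^'d"
    using l by (intro sum.remove) auto
  have base: "(\<chi> c. real (card {m. m < n \<and> m \<noteq> l \<and> k m = c})) = (\<Sum>m\<in>?M. vertex (k m) :: real^'d)"
  proof -
    have "(\<Sum>m\<in>?M. vertex (k m) :: real^'d) $ c = real (card {m. m < n \<and> m \<noteq> l \<and> k m = c})" for c
    proof -
      have "(\<Sum>m\<in>?M. vertex (k m) :: real^'d) $ c = (\<Sum>m\<in>?M. of_bool (k m = c))"
        unfolding sum_component by (intro sum.cong) (auto simp: axis_def)
      also have "\<dots> = real (card (?M \<inter> {m. k m = c}))" by simp
      also have "?M \<inter> {m. k m = c} = {m. m < n \<and> m \<noteq> l \<and> k m = c}" by auto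
      finally show ?thesis .
    qed
    then show ?thesis by (simp add: vec_eq_iff)
  qed
  have "coord_face {c} = {vertex c}" for c :: 'd by (simp add: coord_face_eq_hull)
  then have "x \<in> (\<Sum>m<n. coord_face (I m)) \<longleftrightarrow> x \<in> (\<lambda>y. (\<Sum>m\<in>?M. vertex (k m)) + y) ` std_simplex" for x
  proof -
    have "x \<in> (\<Sum>m<n. coord_face (I m)) \<longleftrightarrow> (\<exists>b. (\<forall>m<n. b m \<in> coord_face (I m)) \<and> x = b l + (\<Sum>m\<in>?M. b m))"
      unfolding mem_Minkowski_sum_iff split ..
    also have "\<dots> \<longleftrightarrow> (\<exists>y\<in>std_simplex. x = y + (\<Sum>m\<in>?M. vertex (k m)))"
    proof
      assume "\<exists>b. (\<forall>m<n. b m \<in> coord_face (I m)) \<and> x = b l + (\<Sum>m\<in>?M. b m)"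
      then obtain b where b: "\<forall>m<n. b m \<in> coord_face (I m)" "x = b l + (\<Sum>m\<in>?M. b m)" by blast
      have "b m = vertex (k m)" if "m \<in> ?M" for m
        using b(1) that single \<open>\<And>c. coord_face {c} = {vertex c}\<close> by force
      then show "\<exists>y\<in>std_simplex. x = y + (\<Sum>m\<in>?M. vertex (k m))"
        using b l UNIV by (intro bexI[of _ "b l"]) (auto simp: std_simplex_eq_coord_face)
    next
      assume "\<exists>y\<in>std_simplex. x = y + (\<Sum>m\<in>?M. vertex (k m))"
      then obtain y where y: "y \<in> coord_face UNIV" "x = y + (\<Sum>m\<in>?M. vertex (k m))"
        by (auto simp: std_simplex_eq_coord_face)
      let ?b = "\<lambda>m. if m = l then y else vertex (k m)"
      have "(\<Sum>m\<in>?M. ?b m) = (\<Sum>m\<in>?M. vertex (k m))" by (intro sum.cong) auto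
      then show "\<exists>b. (\<forall>m<n. b m \<in> coord_face (I m)) \<and> x = b l + (\<Sum>m\<in>?M. b m)"
        using y l UNIV single by (intro exI[of _ ?b]) (auto intro: vertex_in_coord_face)
    qed
    finally show ?thesis by (auto simp: add.commute)
  qed
  then show ?thesis unfolding unit_simplex_def base by blast
qed

lemma aff_dim_unit_simplex: "aff_dim (unit_simplex x :: (real^'d) set) = int CARD('d) - 1"
  unfolding unit_simplex_def by (simp add: aff_dim_translation_eq std_simplex_eq_coord_face aff_dim_coord_face)

lemma unit_simplex_in_full_cells:
  fixes W :: "nat \<Rightarrow> real^'d"
  assumes l: "l < n" and gap: "\<And>m c. m < n \<Longrightarrow> m \<noteq> l \<Longrightarrow> c \<noteq> k m \<Longrightarrow> W m $ k m - W l $ k m < W m $ c - W l $ c"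
  shows "unit_simplex (\<lambda>c. card {m. m < n \<and> m \<noteq> l \<and> k m = c}) \<in> full_cells n W"
proof -
  have "tight (W l) (W l) = UNIV"
    using slack_min_eqI[of 0 "W l" "W l"] by (auto simp: tight_def)
  moreover have "tight (W m) (W l) = {k m}" if "m < n" "m \<noteq> l" for m
  proof -
    have "W m $ k m - W l $ k m \<le> W m $ c - W l $ c" for c
      using gap[OF that, of c] by (cases "c = k m") auto
    then have "slack_min (W m) (W l) = W m $ k m - W l $ k m" by (intro slack_min_eqI) auto
    then show ?thesis using gap[OF that] by (force simp: tight_def)
  qed
  ultimately have "regular_cell n W (W l) = unit_simplex (\<lambda>c. card {m. m < n \<and> m \<noteq> l \<and> k m = c})"
    unfolding regular_cell_def using l by (intro Minkowski_sum_unit_simplex) auto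
  then show ?thesis
    unfolding full_cells_def using aff_dim_unit_simplex by (metis (mono_tags, lifting) mem_Collect_eq rangeI)
qed

lemma edge_position_commute: "edge_position i j = edge_position j i"
  by (auto simp: edge_position_def)

lemma edge_position_eq_0_iff [simp]: "edge_position i j c = 0 \<longleftrightarrow> c \<noteq> i \<and> c \<noteq> j"
  by (auto simp: edge_position_def)

text \<open>One of the two orders of the ends works: if both failed, an end of \<open>x\<close> would lie on \<open>y\<close> and on
  \<open>z\<close>, or one of these would contain both ends of \<open>x\<close> and be equal to it. If \<open>x\<close> is a loop there is
  nothing to choose.\<close>

lemma edge_orientation:
  fixes x y z :: "'d::finite \<Rightarrow> nat"
  assumes deg: "(\<Sum>c\<in>UNIV. x c) = 2" "(\<Sum>c\<in>UNIV. y c) = 2" "(\<Sum>c\<in>UNIV. z c) = 2"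
    and ne: "x \<noteq> y" "x \<noteq> z" and common: "\<And>c. x c = 0 \<or> y c = 0 \<or> z c = 0"
  obtains u v where "x = edge_position u v" "y u \<noteq> 0 \<Longrightarrow> u = v" "z v \<noteq> 0 \<Longrightarrow> u = v"
proof -
  obtain p where "x p \<noteq> 0" using deg(1) by (metis sum.neutral zero_neq_numeral)
  then obtain q where x: "x = edge_position p q" using position_of_degree_2[OF deg(1), of p] by auto
  have eq: "w = x" if "p \<noteq> q" "w p \<noteq> 0" "w q \<noteq> 0" "(\<Sum>c\<in>UNIV. w c) = 2" for w
  proof -
    have "\<forall>c. x c \<le> w c" using that by (auto simp: x edge_position_def Suc_le_eq)
    then show ?thesis using that(4) deg(1) pointwise_le_sum_eq_imp_eq[of x w] by simp
  qed
  have "p = q \<or> (y p = 0 \<and> z q = 0) \<or> (y q = 0 \<and> z p = 0)"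
    using eq[of y] eq[of z] deg ne common[of p] common[of q] by (auto simp: x)
  then show ?thesis
  proof (elim disjE conjE)
    assume "y q = 0" "z p = 0"
    then show ?thesis using that[of q p] x edge_position_commute[of p q] by simp
  qed (use that[of p q] x in simp_all)
qed

text \<open>For \<open>l\<close> in \<open>{0, 1, 2}\<close>, the end \<open>u\<^sub>l\<close> of the edge \<open>l\<close> is given to the edge \<open>l + 1\<close> and the end \<open>v\<^sub>l\<close>
  to the edge \<open>l + 2\<close>, modulo 3. An end that lies on the edge to which it is given must be the
  other end as well, which is given to the third edge.\<close>

definition compatible_orientation :: "'d \<Rightarrow> 'd \<Rightarrow> 'd \<Rightarrow> 'd \<Rightarrow> 'd \<Rightarrow> 'd \<Rightarrow> bool" where
  "compatible_orientation u0 v0 u1 v1 u2 v2 \<longleftrightarrow>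
    (u0 = u1 \<or> u0 = v1 \<longrightarrow> u0 = v0) \<and> (v0 = u2 \<or> v0 = v2 \<longrightarrow> u0 = v0) \<and>
    (u1 = u2 \<or> u1 = v2 \<longrightarrow> u1 = v1) \<and> (v1 = u0 \<or> v1 = v0 \<longrightarrow> u1 = v1) \<and>
    (u2 = u0 \<or> u2 = v0 \<longrightarrow> u2 = v2) \<and> (v2 = u1 \<or> v2 = v1 \<longrightarrow> u2 = v2) \<and>
    \<not> (u0 = v0 \<and> u1 = v1 \<and> u0 = u1) \<and> \<not> (u1 = v1 \<and> u2 = v2 \<and> u1 = u2) \<and>
    \<not> (u2 = v2 \<and> u0 = v0 \<and> u2 = u0)"

lemma compatible_orientation_rotate:
  "compatible_orientation u0 v0 u1 v1 u2 v2 \<Longrightarrow> compatible_orientation u1 v1 u2 v2 u0 v0"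
  unfolding compatible_orientation_def by blast

lemma compatible_orientation_reflect:
  "compatible_orientation u0 v0 u1 v1 u2 v2 \<Longrightarrow> compatible_orientation v0 u0 v2 u2 v1 u1"
  unfolding compatible_orientation_def by metis

text \<open>The weight of an edge with ends \<open>u\<close> and \<open>v\<close> when the other two edges give it the ends \<open>v'\<close> and
  \<open>u'\<close>.\<close>

definition orientation_weight :: "'d \<Rightarrow> 'd \<Rightarrow> 'd \<Rightarrow> 'd \<Rightarrow> 'd \<Rightarrow> real" where
  "orientation_weight u v v' u' c = of_bool (c = u) + of_bool (c = v) - of_bool (c = v') - of_bool (c = u')"

text \<open>With \<open>c\<^sub>l\<^sub>m\<close> as the end of the edge \<open>l\<close> given to \<open>m\<close>, the difference of the weights of the edges 0 and 1
  at \<open>c\<close> counts \<open>c\<^sub>0\<^sub>1 = c\<close> and \<open>c\<^sub>1\<^sub>0 = c\<close> with factors \<open>2\<close> and \<open>-2\<close>, \<open>c\<^sub>0\<^sub>2 = c\<close> and \<open>c\<^sub>2\<^sub>1 = c\<close> with factor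
  \<open>1\<close>, and \<open>c\<^sub>1\<^sub>2 = c\<close> and \<open>c\<^sub>2\<^sub>0 = c\<close> with factor \<open>-1\<close>. At \<open>c = c\<^sub>0\<^sub>1\<close> asymmetry excludes
  \<open>c\<^sub>1\<^sub>0 = c\<close> and transitivity compensates the other negative contributions; elsewhere transitivity excludes that both \<open>c\<^sub>0\<^sub>2\<close> and \<open>c\<^sub>2\<^sub>1\<close> are \<open>c\<close>. The
  other pairs of edges follow by rotation and reflection.\<close>

lemma orientation_gap:
  assumes "compatible_orientation u0 v0 u1 v1 u2 v2"
  shows "2 \<le> orientation_weight u0 v0 v1 u2 u0 - orientation_weight u1 v1 v2 u0 u0"
    and "c \<noteq> u0 \<Longrightarrow> orientation_weight u0 v0 v1 u2 c - orientation_weight u1 v1 v2 u0 c \<le> 1"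
proof -
  have "u0 \<noteq> v1" "u0 = u1 \<Longrightarrow> u0 = v0" "u0 = u2 \<Longrightarrow> u0 = v2"
    using assms unfolding compatible_orientation_def by metis+
  then have "of_bool (u0 = v1) = (0::real)" "of_bool (u0 = u1) \<le> (of_bool (u0 = v0) :: real)"
    "of_bool (u0 = u2) \<le> (of_bool (u0 = v2) :: real)"
    by auto
  moreover have "of_bool (u0 = u0) = (1::real)" by simp
  ultimately show "2 \<le> orientation_weight u0 v0 v1 u2 u0 - orientation_weight u1 v1 v2 u0 u0"
    unfolding orientation_weight_def by linarith
  assume "c \<noteq> u0"
  then have "\<not> (c = v0 \<and> c = v2)"
    using assms unfolding compatible_orientation_def by metis
  then have "of_bool (c = v0) + of_bool (c = v2) \<le> (1::real)" by auto
  moreover have "of_bool (c = u0) = (0::real)" using \<open>c \<noteq> u0\<close> by simp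
  moreover have "0 \<le> (of_bool (c = v1) :: real)" "0 \<le> (of_bool (c = u1) :: real)"
    "0 \<le> (of_bool (c = u2) :: real)" by simp_all
  ultimately show "orientation_weight u0 v0 v1 u2 c - orientation_weight u1 v1 v2 u0 c \<le> 1"
    unfolding orientation_weight_def by linarith
qed

lemma unit_simplex_edge_position_in_full_cells:
  fixes W :: "nat \<Rightarrow> real^'d"
  assumes lmk: "{l, m, k} = {0, 1, 2}"
    and gap_m: "\<And>c. c \<noteq> u \<Longrightarrow> W m $ u - W l $ u < W m $ c - W l $ c"
    and gap_k: "\<And>c. c \<noteq> v \<Longrightarrow> W k $ v - W l $ v < W k $ c - W l $ c"
  shows "unit_simplex (edge_position u v) \<in> full_cells 3 W"
proof -
  have ne: "l \<noteq> m" "l \<noteq> k" "m \<noteq> k" and lt: "j < 3 \<longleftrightarrow> j \<in> {l, m, k}" for j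
  proof -
    have "card {l, m, k} = 3" unfolding lmk by simp
    then show "l \<noteq> m" "l \<noteq> k" "m \<noteq> k" by (auto simp: card_insert_if split: if_splits)
    show "j < 3 \<longleftrightarrow> j \<in> {l, m, k}" for j unfolding lmk by auto
  qed
  let ?r = "\<lambda>j. if j = m then u else v"
  have "card {j. j < 3 \<and> j \<noteq> l \<and> ?r j = c} = edge_position u v c" for c
  proof -
    have "{j. j < 3 \<and> j \<noteq> l \<and> ?r j = c} = (if u = c then {m} else {}) \<union> (if v = c then {k} else {})"
      using ne by (auto simp: lt)
    then show ?thesis using ne by (auto simp: edge_position_def)
  qed
  moreover have "unit_simplex (\<lambda>c. card {j. j < 3 \<and> j \<noteq> l \<and> ?r j = c}) \<in> full_cells 3 W"
    using ne gap_m gap_k by (intro unit_simplex_in_full_cells) (auto simp: lt)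
  ultimately show ?thesis by simp
qed

lemma no_common_coordinate_imp_extends:
  fixes x0 x1 x2 :: "'d::finite \<Rightarrow> nat"
  assumes deg: "(\<Sum>c\<in>UNIV. x0 c) = 2" "(\<Sum>c\<in>UNIV. x1 c) = 2" "(\<Sum>c\<in>UNIV. x2 c) = 2"
    and ne: "x0 \<noteq> x1" "x1 \<noteq> x2" "x0 \<noteq> x2" and common: "\<And>c. x0 c = 0 \<or> x1 c = 0 \<or> x2 c = 0"
  shows "\<exists>\<C> :: (real^'d) set set. fine_mixed_subdivision 3 \<C> \<and> {unit_simplex x0, unit_simplex x1, unit_simplex x2} \<subseteq> \<C>"
proof -
  obtain u0 v0 where 0: "x0 = edge_position u0 v0" "x1 u0 \<noteq> 0 \<Longrightarrow> u0 = v0" "x2 v0 \<noteq> 0 \<Longrightarrow> u0 = v0"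
    using edge_orientation[OF deg ne(1,3) common] by blast
  have "x1 c = 0 \<or> x2 c = 0 \<or> x0 c = 0" for c using common[of c] by linarith
  then obtain u1 v1 where 1: "x1 = edge_position u1 v1" "x2 u1 \<noteq> 0 \<Longrightarrow> u1 = v1" "x0 v1 \<noteq> 0 \<Longrightarrow> u1 = v1"
    using edge_orientation[OF deg(2,3,1) ne(2) ne(1)[symmetric]] by blast
  have "x2 c = 0 \<or> x0 c = 0 \<or> x1 c = 0" for c using common[of c] by linarith
  then obtain u2 v2 where 2: "x2 = edge_position u2 v2" "x0 u2 \<noteq> 0 \<Longrightarrow> u2 = v2" "x1 v2 \<noteq> 0 \<Longrightarrow> u2 = v2"
    using edge_orientation[OF deg(3,1,2) ne(3,2)[symmetric]] by blast
  have "\<not> (u0 = v0 \<and> u1 = v1 \<and> u0 = u1)" "\<not> (u1 = v1 \<and> u2 = v2 \<and> u1 = u2)"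
    "\<not> (u2 = v2 \<and> u0 = v0 \<and> u2 = u0)"
    using ne 0(1) 1(1) 2(1) by blast+
  then have ori: "compatible_orientation u0 v0 u1 v1 u2 v2"
    using 0(2,3) 1(2,3) 2(2,3) unfolding compatible_orientation_def 0(1) 1(1) 2(1) edge_position_eq_0_iff
    by blast
  define W0 :: "nat \<Rightarrow> real^'d" where "W0 = (\<lambda>l. \<chi> c.
    if l = 0 then orientation_weight u0 v0 v1 u2 c
    else if l = 1 then orientation_weight u1 v1 v2 u0 c else orientation_weight u2 v2 v0 u1 c)"
  have W0: "W0 0 $ c = orientation_weight u0 v0 v1 u2 c" "W0 1 $ c = orientation_weight u1 v1 v2 u0 c"
    "W0 2 $ c = orientation_weight u2 v2 v0 u1 c" for c
    by (simp_all add: W0_def)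
  have swap: "orientation_weight u v v' u' = orientation_weight v u u' v'" for u v u' v' :: 'd
    by (auto simp: orientation_weight_def)
  \<comment> \<open>The margin is 1, and the four entries compared change by less than 1/8 each.\<close>
  obtain W where gen: "generic 3 W" and near: "\<And>l c. \<bar>W l $ c - W0 l $ c\<bar> < 1/8"
    using generic_perturbation[of "1/8" 3 W0] by auto
  have gap: "W m $ s - W l $ s < W m $ c - W l $ c"
    if "2 \<le> W0 l $ s - W0 m $ s" "W0 l $ c - W0 m $ c \<le> 1" for l m s c
    using that near[of l s] near[of l c] near[of m s] near[of m c] by linarith
  note rot = compatible_orientation_rotate and refl = compatible_orientation_reflect
  note gaps = orientation_gap[OF ori] orientation_gap[OF refl[OF ori]]
    orientation_gap[OF rot[OF ori]] orientation_gap[OF refl[OF rot[OF ori]]]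
    orientation_gap[OF rot[OF rot[OF ori]]] orientation_gap[OF refl[OF rot[OF rot[OF ori]]]]
  have "unit_simplex x0 \<in> full_cells 3 W" unfolding 0(1)
  proof (rule unit_simplex_edge_position_in_full_cells[of 0 1 2])
    show "W 1 $ u0 - W 0 $ u0 < W 1 $ c - W 0 $ c" if "c \<noteq> u0" for c
      using gaps(1,2) that by (intro gap) (simp_all only: W0)
    show "W 2 $ v0 - W 0 $ v0 < W 2 $ c - W 0 $ c" if "c \<noteq> v0" for c
      using gaps(3,4) that by (intro gap) (simp_all only: W0 swap[of u0] swap[of u2])
  qed simp
  moreover have "unit_simplex x1 \<in> full_cells 3 W" unfolding 1(1)
  proof (rule unit_simplex_edge_position_in_full_cells[of 1 2 0])
    show "W 2 $ u1 - W 1 $ u1 < W 2 $ c - W 1 $ c" if "c \<noteq> u1" for c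
      using gaps(5,6) that by (intro gap) (simp_all only: W0)
    show "W 0 $ v1 - W 1 $ v1 < W 0 $ c - W 1 $ c" if "c \<noteq> v1" for c
      using gaps(7,8) that by (intro gap) (simp_all only: W0 swap[of u0] swap[of u1])
  qed auto
  moreover have "unit_simplex x2 \<in> full_cells 3 W" unfolding 2(1)
  proof (rule unit_simplex_edge_position_in_full_cells[of 2 0 1])
    show "W 0 $ u2 - W 2 $ u2 < W 0 $ c - W 2 $ c" if "c \<noteq> u2" for c
      using gaps(9,10) that by (intro gap) (simp_all only: W0)
    show "W 1 $ v2 - W 2 $ v2 < W 1 $ c - W 2 $ c" if "c \<noteq> v2" for c
      using gaps(11,12) that by (intro gap) (simp_all only: W0 swap[of u1] swap[of u2])
  qed auto
  moreover have "fine_mixed_subdivision 3 (full_cells 3 W)"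
    using gen by (intro fine_mixed_subdivision_full_cells) auto
  ultimately show ?thesis by blast
qed

text \<open>The two directions meet in \<open>spread_out_3_iff\<close>: both being extendable and being spread out
  amount to the three positions having no common coordinate.\<close>

theorem theorem8p11:
  fixes \<S> :: "(real^'d) set set"
  assumes "\<S> \<subseteq> unit_simplices 3" and "card \<S> = 3"
  shows "(\<exists>\<C>. fine_mixed_subdivision 3 \<C> \<and> \<S> \<subseteq> \<C>) \<longleftrightarrow> spread_out 3 \<S>"
proof -
  define X :: "('d \<Rightarrow> nat) set" where "X = {x. (\<Sum>c\<in>UNIV. x c) = 2 \<and> unit_simplex x \<in> \<S>}"
  have deg: "(\<Sum>c\<in>UNIV. x c) = 2" if "x \<in> X" for x using that by (simp add: X_def)
  have \<S>_eq: "\<S> = unit_simplex ` X"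
    using assms(1) by (fastforce simp: X_def unit_simplices_def)
  have "inj_on (unit_simplex :: _ \<Rightarrow> (real^'d) set) X"
    using deg by (intro inj_onI unit_simplex_inject) auto
  then have card: "card X = 3" using assms(2) by (simp add: \<S>_eq card_image)
  have "(\<exists>\<C>. fine_mixed_subdivision 3 \<C> \<and> \<S> \<subseteq> \<C>) \<longleftrightarrow> (\<forall>a. \<exists>x\<in>X. x a = 0)"
  proof
    assume "\<exists>\<C>. fine_mixed_subdivision 3 \<C> \<and> \<S> \<subseteq> \<C>"
    then show "\<forall>a. \<exists>x\<in>X. x a = 0"
      using extends_imp_no_common_coordinate[OF _ _ deg card] unfolding \<S>_eq by blast
  next
    assume zero: "\<forall>a. \<exists>x\<in>X. x a = 0"
    obtain x0 x1 x2 where X: "X = {x0, x1, x2}" and ne: "x0 \<noteq> x1" "x1 \<noteq> x2" "x0 \<noteq> x2"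
      using card by (auto simp: card_3_iff)
    have "x0 c = 0 \<or> x1 c = 0 \<or> x2 c = 0" for c using zero[rule_format, of c] unfolding X by auto
    then show "\<exists>\<C>. fine_mixed_subdivision 3 \<C> \<and> \<S> \<subseteq> \<C>"
      using no_common_coordinate_imp_extends[of x0 x1 x2] deg ne unfolding \<S>_eq X by simp
  qed
  also have "\<dots> \<longleftrightarrow> spread_out 3 \<S>"
    unfolding \<S>_eq using spread_out_3_iff[OF deg card] by simp
  finally show ?thesis .
qed

end
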